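(* Let $(R,\mathfrak m)$ be a complete regular local ring, let $f$ be a nonzero element of $R$, and let $B$ be a big Cohen-Macaulay $R^+$-algebra. Then, for every $t\in\mathbb Q_{\ge 0}$, $f^t\notin \mathfrak mB$ if and only if the $R$-linear map $R\to B$ sending $1$ to $f^t$ splits.
   Context: $R$ is not assumed to have prime characteristic. $R^+$ is the absolute integral closure of the domain $R$, i.e. the integral closure of $R$ in an algebraic closure of its fraction field. A big Cohen-Macaulay $R^+$-algebra is an $R^+$-algebra $B$ such that $\mathfrak m B\neq B$ and every system of parameters of $R$ is a regular sequence on $B$. For $t=a/b$ with $a\in\mathbb Z_{\ge 0}$, $b\in\mathbb Z_{>0}$, $f^t$ denotes (the image in $B$ of) $g^a$ where $g\in R^+$ is any element with $g^b=f$; two choices differ by a root of unity in $R^+$, so neither condition in the statement depends on the choice. The map $R\to B$, $1\mapsto f^t$, splits if there is $\varphi\in\mathrm{Hom}_R(B,R)$ with $\varphi(f^t)=1$. *)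

theory Defs
  imports Complex_Main "HOL-Library.Extended_Nat" "HOL-Algebra.Algebra"
begin

section \<open>Complete regular local rings\<close>

definition krull_dim :: "('a, 'r) ring_scheme \<Rightarrow> enat" where
  "krull_dim R = Sup {enat n | n. \<exists>P :: nat \<Rightarrow> 'a set.
     (\<forall>i\<le>n. primeideal (P i) R) \<and> (\<forall>i<n. P i \<subset> P (Suc i))}"

locale noetherian_local_ring = cring R + noetherian_ring R + maximalideal \<mm> R
  for R (structure) and \<mm> +
  assumes maximal_unique: "maximalideal \<nn> R \<Longrightarrow> \<nn> = \<mm>"

locale regular_local_ring = noetherian_local_ring +
  assumes regular: "\<exists>S \<subseteq> carrier R. finite S \<and> enat (card S) = krull_dim R \<and> Idl S = \<mm>"

text \<open>Powers of ideals are taken in the library's monoid \<^const>\<open>ideals_set\<close> of ideals of \<open>R\<close>.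
  The two conjuncts say that \<open>R \<rightarrow> lim R/I^n\<close> is injective and surjective: an element of
  the limit is given by lifts \<open>x n\<close> of its components modulo \<open>I^n\<close>.\<close>

definition adically_complete :: "('a, 'r) ring_scheme \<Rightarrow> 'a set \<Rightarrow> bool" where
  "adically_complete R I \<longleftrightarrow>
     (\<Inter>n::nat. I [^]\<^bsub>ideals_set R\<^esub> n) = {\<zero>\<^bsub>R\<^esub>} \<and>
     (\<forall>x :: nat \<Rightarrow> 'a.
        (\<forall>n. x n \<in> carrier R) \<and> (\<forall>n. x (Suc n) \<ominus>\<^bsub>R\<^esub> x n \<in> I [^]\<^bsub>ideals_set R\<^esub> n) \<longrightarrow>
        (\<exists>y \<in> carrier R. \<forall>n. y \<ominus>\<^bsub>R\<^esub> x n \<in> I [^]\<^bsub>ideals_set R\<^esub> n))"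

locale complete_regular_local_ring = regular_local_ring +
  assumes complete: "adically_complete R \<mm>"

text \<open>The last condition says that the radical of the ideal \<open>(xs)\<close> is \<open>\<mm>\<close>.\<close>

definition system_of_parameters :: "('a, 'r) ring_scheme \<Rightarrow> 'a set \<Rightarrow> 'a list \<Rightarrow> bool" where
  "system_of_parameters R \<mm> xs \<longleftrightarrow>
     enat (length xs) = krull_dim R \<and> set xs \<subseteq> \<mm> \<and>
     {r \<in> carrier R. \<exists>n::nat. r [^]\<^bsub>R\<^esub> n \<in> Idl\<^bsub>R\<^esub> (set xs)} = \<mm>"


section \<open>Modules\<close>

text \<open>\<open>IM\<close>, the submodule of \<open>M\<close> generated by all products \<open>a x\<close>.\<close>

definition ideal_smult ::
  "('a, 'r) ring_scheme \<Rightarrow> ('a, 'b, 'm) module_scheme \<Rightarrow> 'a set \<Rightarrow> 'b set" where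
  "ideal_smult R M I =
     \<Inter> {N. submodule N R M \<and> (\<forall>a \<in> I. \<forall>x \<in> carrier M. a \<odot>\<^bsub>M\<^esub> x \<in> N)}"

text \<open>The first condition says that \<open>xs ! i\<close> is a nonzerodivisor on
  \<open>M/(xs ! 0, ..., xs ! (i - 1))M\<close>.\<close>

definition regular_sequence ::
  "('a, 'r) ring_scheme \<Rightarrow> ('a, 'b, 'm) module_scheme \<Rightarrow> 'a list \<Rightarrow> bool" where
  "regular_sequence R M xs \<longleftrightarrow> set xs \<subseteq> carrier R \<and>
     (\<forall>i < length xs. \<forall>b \<in> carrier M.
        xs ! i \<odot>\<^bsub>M\<^esub> b \<in> ideal_smult R M (Idl\<^bsub>R\<^esub> (set (take i xs))) \<longrightarrow>
        b \<in> ideal_smult R M (Idl\<^bsub>R\<^esub> (set (take i xs)))) \<and>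
     ideal_smult R M (Idl\<^bsub>R\<^esub> (set xs)) \<noteq> carrier M"

definition big_cohen_macaulay ::
  "('a, 'r) ring_scheme \<Rightarrow> 'a set \<Rightarrow> ('a, 'b, 'm) module_scheme \<Rightarrow> bool" where
  "big_cohen_macaulay R \<mm> M \<longleftrightarrow> ideal_smult R M \<mm> \<noteq> carrier M \<and>
     (\<forall>xs. system_of_parameters R \<mm> xs \<longrightarrow> regular_sequence R M xs)"

definition restrict_scalars ::
  "('a \<Rightarrow> 'l) \<Rightarrow> ('l, 'b, 'm) module_scheme \<Rightarrow> ('a, 'b) module" where
  "restrict_scalars \<iota> M =
     \<lparr>carrier = carrier M, monoid.mult = monoid.mult M, monoid.one = monoid.one M, ring.zero = ring.zero M, ring.add = ring.add M,
      smult = (\<lambda>r x. \<iota> r \<odot>\<^bsub>M\<^esub> x)\<rparr>"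

text \<open>\<open>Hom_R(M, R)\<close>; functions are constrained only on the carrier of \<open>M\<close>.\<close>

definition dual_module ::
  "('a, 'r) ring_scheme \<Rightarrow> ('a, 'b, 'm) module_scheme \<Rightarrow> ('b \<Rightarrow> 'a) set" where
  "dual_module R M = {\<phi> \<in> carrier M \<rightarrow> carrier R.
     (\<forall>x \<in> carrier M. \<forall>y \<in> carrier M. \<phi> (x \<oplus>\<^bsub>M\<^esub> y) = \<phi> x \<oplus>\<^bsub>R\<^esub> \<phi> y) \<and>
     (\<forall>r \<in> carrier R. \<forall>x \<in> carrier M. \<phi> (r \<odot>\<^bsub>M\<^esub> x) = r \<otimes>\<^bsub>R\<^esub> \<phi> x)}"

text \<open>The \<open>R\<close>-linear map \<open>R \<rightarrow> M\<close> with \<open>1 \<mapsto> u\<close> splits.\<close>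

definition splits :: "('a, 'r) ring_scheme \<Rightarrow> ('a, 'b, 'm) module_scheme \<Rightarrow> 'b \<Rightarrow> bool" where
  "splits R M u \<longleftrightarrow> (\<exists>\<phi> \<in> dual_module R M. \<phi> u = \<one>\<^bsub>R\<^esub>)"


section \<open>The absolute integral closure\<close>

text \<open>\<open>L\<close>, with the embedding \<open>\<iota>\<close> of \<open>R\<close>, is an algebraic closure of the fraction field of
  \<open>R\<close>, the latter being realised inside \<open>L\<close> as the subfield generated by the image of \<open>R\<close>.\<close>

definition algebraic_closure_of_fractions ::
  "('a, 'r) ring_scheme \<Rightarrow> ('l, 'k) ring_scheme \<Rightarrow> ('a \<Rightarrow> 'l) \<Rightarrow> bool" where
  "algebraic_closure_of_fractions R L \<iota> \<longleftrightarrow>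
     \<iota> \<in> ring_hom R L \<and> inj_on \<iota> (carrier R) \<and>
     algebraic_closure L (generate_field L (\<iota> ` carrier R))"

text \<open>Library polynomials are coefficient lists with the leading coefficient first, so
  \<open>p \<noteq> []\<close> excludes the zero polynomial, whose \<open>lead_coeff\<close> is unspecified.\<close>

definition absolute_integral_closure ::
  "('a, 'r) ring_scheme \<Rightarrow> ('l, 'k) ring_scheme \<Rightarrow> ('a \<Rightarrow> 'l) \<Rightarrow> ('l, 'k) ring_scheme" where
  "absolute_integral_closure R L \<iota> = L\<lparr>carrier :=
     {x \<in> carrier L. \<exists>p \<in> carrier (univ_poly L (\<iota> ` carrier R)).
        p \<noteq> [] \<and> lead_coeff p = \<one>\<^bsub>L\<^esub> \<and> ring.eval L p x = \<zero>\<^bsub>L\<^esub>}\<rparr>"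

text \<open>All values of \<open>f^t\<close> in the ring \<open>S\<close>: one for each way of writing \<open>t = a/b\<close> and each
  choice of a \<open>b\<close>-th root \<open>g\<close> of \<open>f\<close>.\<close>

definition rational_powers :: "('l, 'k) ring_scheme \<Rightarrow> 'l \<Rightarrow> rat \<Rightarrow> 'l set" where
  "rational_powers S f t = {g [^]\<^bsub>S\<^esub> a | g (a::nat) (b::nat).
     b > 0 \<and> t = of_nat a / of_nat b \<and> g \<in> carrier S \<and> g [^]\<^bsub>S\<^esub> b = f}"

end

theory Submission
  imports Defs
begin

text \<open>The theorem is a case of a statement on modules: if \<open>M\<close> is a big Cohen-Macaulay module over \<open>R\<close> and
  \<open>u \<in> M\<close>, then \<open>u \<notin> \<mm>M\<close> if and only if some functional on \<open>M\<close> takes the value \<open>1\<close> at \<open>u\<close>.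
  A functional sending \<open>u\<close> to \<open>1\<close> sends \<open>\<mm>M\<close> into \<open>\<mm>\<close>, which gives one direction at once.

  For the converse, let \<open>u \<notin> \<mm>M\<close>. The idea is that \<open>M\<close> is free modulo arbitrarily small \<open>\<mm>\<close>-primary
  ideals, with \<open>u\<close> as a member of a basis that is the same for all of them. The \<open>u\<close>-coordinates modulo
  these ideals are compatible and, \<open>R\<close> being complete, they glue to a functional \<open>\<phi> : M \<rightarrow> R\<close> with
  \<open>\<phi> u = 1\<close>.

  In detail, let \<open>S\<close> be a regular system of parameters. Extend \<open>u\<close> to a family \<open>E\<close> in \<open>M\<close> that becomes
  a basis of the vector space \<open>M/\<mm>M\<close> (\<open>exists_basis_mod\<close>). For exponents \<open>a s > 0\<close> let \<open>J\<^sub>a\<close> be the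
  ideal generated by the powers \<open>s ^ a s\<close> with \<open>s \<in> S\<close>. Then \<open>E\<close> is a basis of \<open>M/J\<^sub>aM\<close> over
  \<open>R/J\<^sub>a\<close>, by induction on the sum of the exponents (\<open>basis_mod_powers\<close>). The step raises the exponent of
  one \<open>x \<in> S\<close>: if \<open>A\<close> consists of the powers of the other members of \<open>S\<close>, then \<open>A\<close> followed by \<open>x\<close> is a
  system of parameters, so \<open>x\<close> is a nonzerodivisor on \<open>M/AM\<close>, and a basis modulo \<open>(x^k, A)\<close> and modulo
  \<open>(x, A)\<close> is a basis modulo \<open>(x^(k+1), A)\<close> (\<open>independent_mod_insert_pow_Suc\<close>,
  \<open>spans_mod_insert_pow_Suc\<close>). Working with all exponent vectors, rather than with \<open>\<mm>^n\<close>, makes it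
  possible to change one exponent at a time. The gluing is \<open>coordinate_functional\<close>.\<close>

section \<open>Adding a generator to an ideal\<close>

lemma (in cring) mem_Idl_insert_iff:
  assumes A: "A \<subseteq> carrier R" and y: "y \<in> carrier R"
  shows "r \<in> Idl (insert y A) \<longleftrightarrow> (\<exists>c \<in> carrier R. \<exists>s \<in> Idl A. r = y \<otimes> c \<oplus> s)"
proof -
  have iA: "ideal (Idl A) R" and iyA: "ideal (Idl (insert y A)) R"
    using A y by (auto intro: genideal_ideal)
  have "Idl (insert y A) = PIdl y <+> Idl A"
  proof
    have "ideal (PIdl y <+> Idl A) R"
      using add_ideals cgenideal_ideal iA y by blast
    moreover have "y \<in> PIdl y <+> Idl A"
      using cgenideal_self[OF y] additive_subgroup.zero_closed[OF ideal.axioms(1)[OF iA]] y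
      unfolding set_add_def' by force
    moreover have "A \<subseteq> PIdl y <+> Idl A"
    proof
      fix a assume "a \<in> A"
      then have "a \<in> Idl A" "a \<in> carrier R" using genideal_self A by auto
      moreover have "\<zero> \<in> PIdl y"
        using cgenideal_ideal[OF y] additive_subgroup.zero_closed ideal.axioms(1) by blast
      ultimately show "a \<in> PIdl y <+> Idl A" unfolding set_add_def' by force
    qed
    ultimately show "Idl (insert y A) \<subseteq> PIdl y <+> Idl A"
      by (intro genideal_minimal) auto
    have "PIdl y \<subseteq> Idl (insert y A)"
      using iyA A y by (intro cgenideal_minimal) (auto intro: genideal_self[THEN subsetD])
    moreover have "Idl A \<subseteq> Idl (insert y A)"
      using A y by (intro subset_Idl_subset) auto
    ultimately show "PIdl y <+> Idl A \<subseteq> Idl (insert y A)"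
      unfolding set_add_def'
      using additive_subgroup.a_closed[OF ideal.axioms(1)[OF iyA]] by blast
  qed
  then show ?thesis
    unfolding set_add_def' cgenideal_def using y by (auto simp: m_comm)
qed

context module begin

lemma smult_mem_ideal_smult:
  "a \<in> I \<Longrightarrow> x \<in> carrier M \<Longrightarrow> a \<odot>\<^bsub>M\<^esub> x \<in> ideal_smult R M I"
  by (auto simp: ideal_smult_def)

lemma ideal_smult_least:
  assumes "submodule N R M" and "\<And>a x. a \<in> I \<Longrightarrow> x \<in> carrier M \<Longrightarrow> a \<odot>\<^bsub>M\<^esub> x \<in> N"
  shows "ideal_smult R M I \<subseteq> N"
  using assms by (auto simp: ideal_smult_def)

lemma submodule_ideal_smult:
  assumes "I \<subseteq> carrier R"
  shows "submodule (ideal_smult R M I) R M"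
proof (rule submoduleI)
  show "ideal_smult R M I \<subseteq> carrier M"
    using assms by (intro ideal_smult_least carrier_is_submodule) auto
  show "\<zero>\<^bsub>M\<^esub> \<in> ideal_smult R M I"
    using subgroup.one_closed[OF submodule.axioms(1)] by (fastforce simp: ideal_smult_def)
qed (simp_all add: ideal_smult_def submoduleE)

lemma submodule_multiples_plus:
  assumes "submodule N R M" and y: "y \<in> carrier R"
  shows "submodule {y \<odot>\<^bsub>M\<^esub> m \<oplus>\<^bsub>M\<^esub> z | m z. m \<in> carrier M \<and> z \<in> N} R M"
    (is "submodule ?K R M")
proof (rule submoduleI)
  interpret N: submodule N R M by (rule assms)
  note NE = submoduleE[OF assms(1)]
  have NM: "\<And>z. z \<in> N \<Longrightarrow> z \<in> carrier M" using NE(1) by auto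
  show "?K \<subseteq> carrier M" using NM y by auto
  show "\<zero>\<^bsub>M\<^esub> \<in> ?K" using N.one_closed y by force
  fix v assume "v \<in> ?K"
  then obtain m z where v: "v = y \<odot>\<^bsub>M\<^esub> m \<oplus>\<^bsub>M\<^esub> z" "m \<in> carrier M" "z \<in> N" by blast
  have "\<ominus>\<^bsub>M\<^esub> v = y \<odot>\<^bsub>M\<^esub> (\<ominus>\<^bsub>M\<^esub> m) \<oplus>\<^bsub>M\<^esub> (\<ominus>\<^bsub>M\<^esub> z)"
    using v NM y by (simp add: M.minus_add smult_r_minus)
  then show "\<ominus>\<^bsub>M\<^esub> v \<in> ?K" using v(2,3) NE(3)[of z] M.a_inv_closed[of m] by blast
  {
    fix a assume a: "a \<in> carrier R"
    have "a \<odot>\<^bsub>M\<^esub> v = y \<odot>\<^bsub>M\<^esub> (a \<odot>\<^bsub>M\<^esub> m) \<oplus>\<^bsub>M\<^esub> a \<odot>\<^bsub>M\<^esub> z"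
      using v NM y a by (simp add: smult_r_distr smult_assoc1[symmetric] R.m_comm)
    then show "a \<odot>\<^bsub>M\<^esub> v \<in> ?K" using v(2,3) NE(4)[of a z] a smult_closed[of a m] by blast
  }
  fix w assume "w \<in> ?K"
  then obtain m' z' where w: "w = y \<odot>\<^bsub>M\<^esub> m' \<oplus>\<^bsub>M\<^esub> z'" "m' \<in> carrier M" "z' \<in> N" by blast
  have "v \<oplus>\<^bsub>M\<^esub> w = y \<odot>\<^bsub>M\<^esub> (m \<oplus>\<^bsub>M\<^esub> m') \<oplus>\<^bsub>M\<^esub> (z \<oplus>\<^bsub>M\<^esub> z')"
    using v w NM y by (simp add: smult_r_distr M.a_ac)
  then show "v \<oplus>\<^bsub>M\<^esub> w \<in> ?K" using v(2,3) w(2,3) NE(5)[of z z'] by blast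
qed

text \<open>Singles out one generator, so that its exponent can be changed while the others stay fixed.\<close>

lemma mem_ideal_smult_insert_iff:
  assumes A: "A \<subseteq> carrier R" and y: "y \<in> carrier R"
  shows "w \<in> ideal_smult R M (Idl (insert y A)) \<longleftrightarrow>
    (\<exists>m \<in> carrier M. \<exists>z \<in> ideal_smult R M (Idl A). w = y \<odot>\<^bsub>M\<^esub> m \<oplus>\<^bsub>M\<^esub> z)"
proof -
  let ?N = "ideal_smult R M (Idl A)" and ?N' = "ideal_smult R M (Idl (insert y A))"
  let ?K = "{y \<odot>\<^bsub>M\<^esub> m \<oplus>\<^bsub>M\<^esub> z | m z. m \<in> carrier M \<and> z \<in> ?N}"
  have iA: "Idl A \<subseteq> carrier R" and iyA: "Idl (insert y A) \<subseteq> carrier R"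
    using A y by (auto dest: additive_subgroup.a_Hcarr[OF ideal.axioms(1)[OF R.genideal_ideal], rotated])
  note N = submodule_ideal_smult[OF iA] and N' = submodule_ideal_smult[OF iyA]
  have NM: "?N \<subseteq> carrier M" using submoduleE(1)[OF N] .
  have "?N' \<subseteq> ?K"
  proof (rule ideal_smult_least[OF submodule_multiples_plus[OF N y]])
    fix a x assume a: "a \<in> Idl (insert y A)" and x: "x \<in> carrier M"
    obtain c s where cs: "c \<in> carrier R" "s \<in> Idl A" "a = y \<otimes> c \<oplus> s"
      using a R.mem_Idl_insert_iff[OF A y] by blast
    have "s \<in> carrier R" using cs iA by auto
    then have "a \<odot>\<^bsub>M\<^esub> x = y \<odot>\<^bsub>M\<^esub> (c \<odot>\<^bsub>M\<^esub> x) \<oplus>\<^bsub>M\<^esub> s \<odot>\<^bsub>M\<^esub> x"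
      using cs x y by (simp add: smult_l_distr smult_assoc1)
    then show "a \<odot>\<^bsub>M\<^esub> x \<in> ?K"
      using smult_mem_ideal_smult[OF cs(2) x] cs x by blast
  qed
  moreover have "?K \<subseteq> ?N'"
  proof -
    have "?N \<subseteq> ?N'"
    proof (rule ideal_smult_least[OF N'])
      fix a x assume "a \<in> Idl A" and x: "x \<in> carrier M"
      then have "a \<in> Idl (insert y A)" using R.subset_Idl_subset[of "insert y A" A] A y R.subset_Idl_subset by blast
      then show "a \<odot>\<^bsub>M\<^esub> x \<in> ?N'" using x by (rule smult_mem_ideal_smult)
    qed
    moreover have "y \<in> Idl (insert y A)" using R.genideal_self A y by (metis insert_subset)
    ultimately show ?thesis using smult_mem_ideal_smult[of y "Idl (insert y A)"] submoduleE(5)[OF N'] by auto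
  qed
  ultimately have "?N' = ?K" by (rule equalityI)
  then show ?thesis by auto
qed

end

section \<open>Spanning and independence modulo an ideal\<close>

definition linear_span :: "('a, 'r) ring_scheme \<Rightarrow> ('a, 'b, 'm) module_scheme \<Rightarrow> 'b set \<Rightarrow> 'b set" where
  "linear_span R M E = {\<Oplus>\<^bsub>M\<^esub>e\<in>F. c e \<odot>\<^bsub>M\<^esub> e | c F. finite F \<and> F \<subseteq> E \<and> c \<in> F \<rightarrow> carrier R}"

text \<open>Independence of the image of \<open>E\<close> in \<open>M/IM\<close> over \<open>R/I\<close>, phrased in \<open>M\<close> itself so that one and the
  same family \<open>E\<close> can be compared for varying \<open>I\<close>.\<close>

definition independent_mod ::
  "('a, 'r) ring_scheme \<Rightarrow> ('a, 'b, 'm) module_scheme \<Rightarrow> 'a set \<Rightarrow> 'b set \<Rightarrow> bool" where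
  "independent_mod R M I E \<longleftrightarrow> (\<forall>F c. finite F \<longrightarrow> F \<subseteq> E \<longrightarrow> c \<in> F \<rightarrow> carrier R \<longrightarrow>
     (\<Oplus>\<^bsub>M\<^esub>e\<in>F. c e \<odot>\<^bsub>M\<^esub> e) \<in> ideal_smult R M I \<longrightarrow> c ` F \<subseteq> I)"

definition spans_mod ::
  "('a, 'r) ring_scheme \<Rightarrow> ('a, 'b, 'm) module_scheme \<Rightarrow> 'a set \<Rightarrow> 'b set \<Rightarrow> bool" where
  "spans_mod R M I E \<longleftrightarrow>
     (\<forall>m \<in> carrier M. \<exists>w \<in> linear_span R M E. \<exists>z \<in> ideal_smult R M I. m = w \<oplus>\<^bsub>M\<^esub> z)"

lemma (in abelian_group) add_minus_cancel:
  assumes "a \<in> carrier G" "b \<in> carrier G"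
  shows "b \<oplus> (a \<ominus> b) = a"
  using assms by (simp add: minus_eq a_lcomm r_neg)

lemma (in abelian_group) minus_eq_minusI:
  assumes "a \<oplus> b = c \<oplus> d" "a \<in> carrier G" "b \<in> carrier G" "c \<in> carrier G" "d \<in> carrier G"
  shows "c \<ominus> a = b \<ominus> d"
proof -
  have "c \<ominus> a = (c \<oplus> d) \<ominus> d \<ominus> a"
    using assms(2-5) by (simp add: minus_eq a_assoc r_neg)
  also have "\<dots> = (b \<oplus> a) \<ominus> d \<ominus> a"
    using assms by (simp add: a_comm)
  also have "\<dots> = b \<ominus> d"
    using assms(2-5) by (simp add: minus_eq a_assoc) (metis a_inv_closed a_lcomm r_neg r_zero)
  finally show ?thesis .
qed

context module begin

lemma Idl_subset_carrier: "A \<subseteq> carrier R \<Longrightarrow> Idl A \<subseteq> carrier R"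
  by (auto dest: additive_subgroup.a_Hcarr[OF ideal.axioms(1)[OF R.genideal_ideal], rotated])

lemma finsum_smult_extend:
  assumes "finite G" "F \<subseteq> G" "G \<subseteq> carrier M" "c \<in> F \<rightarrow> carrier R"
  shows "(\<Oplus>\<^bsub>M\<^esub>e\<in>F. c e \<odot>\<^bsub>M\<^esub> e) = (\<Oplus>\<^bsub>M\<^esub>e\<in>G. (if e \<in> F then c e else \<zero>) \<odot>\<^bsub>M\<^esub> e)"
  using assms by (intro M.add.finprod_mono_neutral_cong_left) (auto simp: Pi_iff subset_iff)

lemma finsum_smult_add:
  assumes "finite F" "F \<subseteq> carrier M" "c \<in> F \<rightarrow> carrier R" "d \<in> F \<rightarrow> carrier R"
  shows "(\<Oplus>\<^bsub>M\<^esub>e\<in>F. (c e \<oplus> d e) \<odot>\<^bsub>M\<^esub> e) =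
    (\<Oplus>\<^bsub>M\<^esub>e\<in>F. c e \<odot>\<^bsub>M\<^esub> e) \<oplus>\<^bsub>M\<^esub> (\<Oplus>\<^bsub>M\<^esub>e\<in>F. d e \<odot>\<^bsub>M\<^esub> e)"
proof -
  have "(\<Oplus>\<^bsub>M\<^esub>e\<in>F. (c e \<oplus> d e) \<odot>\<^bsub>M\<^esub> e) = (\<Oplus>\<^bsub>M\<^esub>e\<in>F. c e \<odot>\<^bsub>M\<^esub> e \<oplus>\<^bsub>M\<^esub> d e \<odot>\<^bsub>M\<^esub> e)"
    using assms by (intro M.finsum_cong') (auto simp: Pi_iff subset_iff smult_l_distr)
  also have "\<dots> = (\<Oplus>\<^bsub>M\<^esub>e\<in>F. c e \<odot>\<^bsub>M\<^esub> e) \<oplus>\<^bsub>M\<^esub> (\<Oplus>\<^bsub>M\<^esub>e\<in>F. d e \<odot>\<^bsub>M\<^esub> e)"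
    using assms by (intro M.finsum_addf) (auto simp: Pi_iff subset_iff)
  finally show ?thesis .
qed

lemma finsum_smult_mult:
  assumes "finite F" "F \<subseteq> carrier M" "c \<in> F \<rightarrow> carrier R" "r \<in> carrier R"
  shows "(\<Oplus>\<^bsub>M\<^esub>e\<in>F. (r \<otimes> c e) \<odot>\<^bsub>M\<^esub> e) = r \<odot>\<^bsub>M\<^esub> (\<Oplus>\<^bsub>M\<^esub>e\<in>F. c e \<odot>\<^bsub>M\<^esub> e)"
proof -
  have "(\<Oplus>\<^bsub>M\<^esub>e\<in>F. (r \<otimes> c e) \<odot>\<^bsub>M\<^esub> e) = (\<Oplus>\<^bsub>M\<^esub>e\<in>F. r \<odot>\<^bsub>M\<^esub> (c e \<odot>\<^bsub>M\<^esub> e))"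
    using assms by (intro M.finsum_cong') (auto simp: Pi_iff subset_iff smult_assoc1)
  also have "\<dots> = r \<odot>\<^bsub>M\<^esub> (\<Oplus>\<^bsub>M\<^esub>e\<in>F. c e \<odot>\<^bsub>M\<^esub> e)"
    using assms by (intro finsum_smult_ldistr[symmetric]) (auto simp: Pi_iff subset_iff)
  finally show ?thesis .
qed

lemma finsum_mem_submodule:
  assumes "submodule N R M" "finite F" "\<And>e. e \<in> F \<Longrightarrow> g e \<in> N"
  shows "(\<Oplus>\<^bsub>M\<^esub>e\<in>F. g e) \<in> N"
  using assms(2,3)
proof (induction F rule: finite_induct)
  case empty
  then show ?case using subgroup.one_closed[OF submodule.axioms(1)[OF assms(1)]] by simp
next
  case (insert x F)
  moreover have "g \<in> F \<rightarrow> carrier M" "g x \<in> carrier M"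
    using insert.prems submoduleE(1)[OF assms(1)] by auto
  ultimately show ?case using submoduleE(5)[OF assms(1)] by (simp add: M.finsum_insert)
qed

lemma linear_spanI:
  "finite F \<Longrightarrow> F \<subseteq> E \<Longrightarrow> c \<in> F \<rightarrow> carrier R \<Longrightarrow> (\<Oplus>\<^bsub>M\<^esub>e\<in>F. c e \<odot>\<^bsub>M\<^esub> e) \<in> linear_span R M E"
  unfolding linear_span_def by (intro CollectI exI[of _ c] exI[of _ F]) simp

lemma submodule_linear_span:
  assumes E: "E \<subseteq> carrier M"
  shows "submodule (linear_span R M E) R M"
proof (rule submoduleI)
  show "linear_span R M E \<subseteq> carrier M"
    using E unfolding linear_span_def by (auto intro!: M.finsum_closed simp: Pi_iff subset_iff)
  show "\<zero>\<^bsub>M\<^esub> \<in> linear_span R M E"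
    unfolding linear_span_def by (intro CollectI exI[of _ "\<lambda>_. \<zero>"] exI[of _ "{}"]) auto
  have smult: "r \<odot>\<^bsub>M\<^esub> v \<in> linear_span R M E"
    if r: "r \<in> carrier R" and v: "v \<in> linear_span R M E" for r v
  proof -
    obtain c F where cF: "finite F" "F \<subseteq> E" "c \<in> F \<rightarrow> carrier R"
      and v_eq: "v = (\<Oplus>\<^bsub>M\<^esub>e\<in>F. c e \<odot>\<^bsub>M\<^esub> e)"
      using v unfolding linear_span_def by blast
    have "r \<odot>\<^bsub>M\<^esub> v = (\<Oplus>\<^bsub>M\<^esub>e\<in>F. (r \<otimes> c e) \<odot>\<^bsub>M\<^esub> e)"
      using finsum_smult_mult[of F c r] cF E r v_eq by auto
    moreover have "(\<lambda>e. r \<otimes> c e) \<in> F \<rightarrow> carrier R" using cF r by auto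
    ultimately show ?thesis using linear_spanI[of F E "\<lambda>e. r \<otimes> c e"] cF by simp
  qed
  then show "r \<odot>\<^bsub>M\<^esub> v \<in> linear_span R M E"
    if "r \<in> carrier R" "v \<in> linear_span R M E" for r v using that .
  show "\<ominus>\<^bsub>M\<^esub> v \<in> linear_span R M E" if v: "v \<in> linear_span R M E" for v
  proof -
    have "v \<in> carrier M" using v \<open>linear_span R M E \<subseteq> carrier M\<close> by auto
    then have "\<ominus>\<^bsub>M\<^esub> v = (\<ominus> \<one>) \<odot>\<^bsub>M\<^esub> v" by (simp add: smult_l_minus)
    then show ?thesis using smult[of "\<ominus> \<one>" v] v by simp
  qed
  show "v \<oplus>\<^bsub>M\<^esub> w \<in> linear_span R M E"
    if vw: "v \<in> linear_span R M E" "w \<in> linear_span R M E" for v w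
  proof -
    obtain c F where cF: "finite F" "F \<subseteq> E" "c \<in> F \<rightarrow> carrier R"
      and v_eq: "v = (\<Oplus>\<^bsub>M\<^esub>e\<in>F. c e \<odot>\<^bsub>M\<^esub> e)"
      using vw unfolding linear_span_def by blast
    obtain d G where dG: "finite G" "G \<subseteq> E" "d \<in> G \<rightarrow> carrier R"
      and w_eq: "w = (\<Oplus>\<^bsub>M\<^esub>e\<in>G. d e \<odot>\<^bsub>M\<^esub> e)"
      using vw unfolding linear_span_def by blast
    define c' where "c' = (\<lambda>e. if e \<in> F then c e else \<zero>)"
    define d' where "d' = (\<lambda>e. if e \<in> G then d e else \<zero>)"
    have c': "c' \<in> F \<union> G \<rightarrow> carrier R" and d': "d' \<in> F \<union> G \<rightarrow> carrier R"
      using cF dG by (auto simp: c'_def d'_def)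
    have FG: "finite (F \<union> G)" "F \<union> G \<subseteq> E" "F \<union> G \<subseteq> carrier M" using cF dG E by auto
    have "v = (\<Oplus>\<^bsub>M\<^esub>e\<in>F \<union> G. c' e \<odot>\<^bsub>M\<^esub> e)" "w = (\<Oplus>\<^bsub>M\<^esub>e\<in>F \<union> G. d' e \<odot>\<^bsub>M\<^esub> e)"
      unfolding v_eq w_eq c'_def d'_def
      using cF dG FG by (intro finsum_smult_extend; auto)+
    then have "v \<oplus>\<^bsub>M\<^esub> w = (\<Oplus>\<^bsub>M\<^esub>e\<in>F \<union> G. (c' e \<oplus> d' e) \<odot>\<^bsub>M\<^esub> e)"
      using finsum_smult_add[OF FG(1,3) c' d'] by simp
    moreover have "(\<lambda>e. c' e \<oplus> d' e) \<in> F \<union> G \<rightarrow> carrier R" using c' d' by (simp add: Pi_iff)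
    ultimately show ?thesis using linear_spanI[of "F \<union> G" E "\<lambda>e. c' e \<oplus> d' e"] FG by simp
  qed
qed

lemma mem_linear_span:
  assumes "e \<in> E" "E \<subseteq> carrier M"
  shows "e \<in> linear_span R M E"
proof -
  have "(\<Oplus>\<^bsub>M\<^esub>x\<in>{e}. \<one> \<odot>\<^bsub>M\<^esub> x) = e" using assms by (simp add: subset_iff)
  then show ?thesis unfolding linear_span_def using assms
    by (intro CollectI exI[of _ "\<lambda>_. \<one>"] exI[of _ "{e}"]) auto
qed

lemma nonzerodivisor_mod_pow:
  assumes y: "y \<in> carrier R"
    and reg: "\<And>b. b \<in> carrier M \<Longrightarrow> y \<odot>\<^bsub>M\<^esub> b \<in> N \<Longrightarrow> b \<in> N"
    and b: "b \<in> carrier M" "(y [^] (k::nat)) \<odot>\<^bsub>M\<^esub> b \<in> N"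
  shows "b \<in> N"
  using b(2)
proof (induction k)
  case 0
  then show ?case using b by simp
next
  case (Suc k)
  have "(y [^] Suc k) \<odot>\<^bsub>M\<^esub> b = y \<odot>\<^bsub>M\<^esub> ((y [^] k) \<odot>\<^bsub>M\<^esub> b)"
    using y b(1) smult_assoc1[of y "y [^] k" b] R.nat_pow_Suc2[of y k] by simp
  with Suc.prems have "y \<odot>\<^bsub>M\<^esub> ((y [^] k) \<odot>\<^bsub>M\<^esub> b) \<in> N" by (simp only:)
  then have "(y [^] k) \<odot>\<^bsub>M\<^esub> b \<in> N" by (rule reg[rotated]) (use y b(1) in simp)
  then show ?case by (rule Suc.IH)
qed

text \<open>Suppose a combination \<open>\<Sum>c\<^sub>e e\<close> lies in \<open>(y^(k+1), A)M\<close>. Independence modulo \<open>(y^k, A)\<close> gives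
  \<open>c\<^sub>e = y^k d\<^sub>e + s\<^sub>e\<close> with \<open>s\<^sub>e \<in> (A)\<close>. Cancelling \<open>y^k\<close> modulo \<open>AM\<close>, which is where the regularity of \<open>y\<close>
  enters, puts \<open>\<Sum>d\<^sub>e e\<close> into \<open>(y, A)M\<close>. Independence modulo \<open>(y, A)\<close> then gives \<open>d\<^sub>e \<in> (y, A)\<close>, hence
  \<open>c\<^sub>e \<in> (y^(k+1), A)\<close>.\<close>

lemma independent_mod_insert_pow_Suc:
  assumes A: "A \<subseteq> carrier R" and y: "y \<in> carrier R" and E: "E \<subseteq> carrier M"
    and reg: "\<And>b. b \<in> carrier M \<Longrightarrow> y \<odot>\<^bsub>M\<^esub> b \<in> ideal_smult R M (Idl A) \<Longrightarrow>
      b \<in> ideal_smult R M (Idl A)"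
    and indk: "independent_mod R M (Idl (insert (y [^] (k::nat)) A)) E"
    and ind1: "independent_mod R M (Idl (insert y A)) E"
  shows "independent_mod R M (Idl (insert (y [^] Suc k) A)) E"
  unfolding independent_mod_def
proof (intro allI impI)
  fix F c
  assume F: "finite F" "F \<subseteq> E" and c: "c \<in> F \<rightarrow> carrier R"
    and mem: "(\<Oplus>\<^bsub>M\<^esub>e\<in>F. c e \<odot>\<^bsub>M\<^esub> e) \<in> ideal_smult R M (Idl (insert (y [^] Suc k) A))"
  let ?N = "ideal_smult R M (Idl A)" and ?q = "y [^] k"
  have FM: "F \<subseteq> carrier M" using F E by auto
  have q: "?q \<in> carrier R" and yk: "y [^] Suc k \<in> carrier R" using y by simp_all
  note N = submodule_ideal_smult[OF Idl_subset_carrier[OF A]]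
  have NM: "\<And>z. z \<in> ?N \<Longrightarrow> z \<in> carrier M" using submoduleE(1)[OF N] by auto
  obtain m z where m: "m \<in> carrier M" and z: "z \<in> ?N"
    and c_eq: "(\<Oplus>\<^bsub>M\<^esub>e\<in>F. c e \<odot>\<^bsub>M\<^esub> e) = (y [^] Suc k) \<odot>\<^bsub>M\<^esub> m \<oplus>\<^bsub>M\<^esub> z"
    using mem mem_ideal_smult_insert_iff[OF A yk] by blast
  have c_eq': "(\<Oplus>\<^bsub>M\<^esub>e\<in>F. c e \<odot>\<^bsub>M\<^esub> e) = ?q \<odot>\<^bsub>M\<^esub> (y \<odot>\<^bsub>M\<^esub> m) \<oplus>\<^bsub>M\<^esub> z"
    using c_eq y m by (simp add: smult_assoc1)
  then have "(\<Oplus>\<^bsub>M\<^esub>e\<in>F. c e \<odot>\<^bsub>M\<^esub> e) \<in> ideal_smult R M (Idl (insert ?q A))"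
    using mem_ideal_smult_insert_iff[OF A q] m y z smult_closed by blast
  then have "c ` F \<subseteq> Idl (insert ?q A)"
    using indk F c unfolding independent_mod_def by blast
  then have "\<forall>e\<in>F. \<exists>d s. d \<in> carrier R \<and> s \<in> Idl A \<and> c e = ?q \<otimes> d \<oplus> s"
    using R.mem_Idl_insert_iff[OF A q] by blast
  then obtain d s where ds: "\<And>e. e \<in> F \<Longrightarrow> d e \<in> carrier R" "\<And>e. e \<in> F \<Longrightarrow> s e \<in> Idl A"
      "\<And>e. e \<in> F \<Longrightarrow> c e = ?q \<otimes> d e \<oplus> s e"
    by metis
  have sR: "\<And>e. e \<in> F \<Longrightarrow> s e \<in> carrier R" using ds(2) Idl_subset_carrier[OF A] by auto
  define D where "D = (\<Oplus>\<^bsub>M\<^esub>e\<in>F. d e \<odot>\<^bsub>M\<^esub> e)"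
  define S where "S = (\<Oplus>\<^bsub>M\<^esub>e\<in>F. s e \<odot>\<^bsub>M\<^esub> e)"
  have D: "D \<in> carrier M" unfolding D_def
    using FM ds by (intro M.finsum_closed) (auto simp: subset_iff)
  have S: "S \<in> ?N" unfolding S_def
    using FM ds F(1) by (intro finsum_mem_submodule[OF N] smult_mem_ideal_smult) auto
  have "(\<Oplus>\<^bsub>M\<^esub>e\<in>F. c e \<odot>\<^bsub>M\<^esub> e) = (\<Oplus>\<^bsub>M\<^esub>e\<in>F. (?q \<otimes> d e \<oplus> s e) \<odot>\<^bsub>M\<^esub> e)"
    using ds sR q FM by (intro M.finsum_cong') (auto simp: subset_iff)
  also have "\<dots> = (\<Oplus>\<^bsub>M\<^esub>e\<in>F. (?q \<otimes> d e) \<odot>\<^bsub>M\<^esub> e) \<oplus>\<^bsub>M\<^esub> S"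
    unfolding S_def using F FM ds sR q by (intro finsum_smult_add) auto
  also have "\<dots> = ?q \<odot>\<^bsub>M\<^esub> D \<oplus>\<^bsub>M\<^esub> S"
    unfolding D_def using F FM ds q by (subst finsum_smult_mult) auto
  finally have "?q \<odot>\<^bsub>M\<^esub> (y \<odot>\<^bsub>M\<^esub> m) \<oplus>\<^bsub>M\<^esub> z = ?q \<odot>\<^bsub>M\<^esub> D \<oplus>\<^bsub>M\<^esub> S"
    using c_eq' by simp
  then have "?q \<odot>\<^bsub>M\<^esub> (D \<ominus>\<^bsub>M\<^esub> y \<odot>\<^bsub>M\<^esub> m) = z \<ominus>\<^bsub>M\<^esub> S"
    using M.minus_eq_minusI[of "?q \<odot>\<^bsub>M\<^esub> (y \<odot>\<^bsub>M\<^esub> m)" z "?q \<odot>\<^bsub>M\<^esub> D" S] q y m D z S NM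
    by (simp add: M.minus_eq smult_r_distr smult_r_minus)
  moreover have "z \<ominus>\<^bsub>M\<^esub> S \<in> ?N"
    using submoduleE[OF N] z S by (simp add: M.minus_eq)
  ultimately have mem': "?q \<odot>\<^bsub>M\<^esub> (D \<ominus>\<^bsub>M\<^esub> y \<odot>\<^bsub>M\<^esub> m) \<in> ?N" by simp
  have "D \<ominus>\<^bsub>M\<^esub> y \<odot>\<^bsub>M\<^esub> m \<in> ?N"
    using D y m by (intro nonzerodivisor_mod_pow[OF y reg _ mem']) simp_all
  moreover have "D = y \<odot>\<^bsub>M\<^esub> m \<oplus>\<^bsub>M\<^esub> (D \<ominus>\<^bsub>M\<^esub> y \<odot>\<^bsub>M\<^esub> m)"
    using D y m by (simp add: M.add_minus_cancel)
  ultimately have "D \<in> ideal_smult R M (Idl (insert y A))"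
    using mem_ideal_smult_insert_iff[OF A y] m by blast
  then have dmem: "d ` F \<subseteq> Idl (insert y A)"
    using ind1 F ds(1) unfolding independent_mod_def D_def by blast
  show "c ` F \<subseteq> Idl (insert (y [^] Suc k) A)"
  proof (intro image_subsetI)
    fix e assume e: "e \<in> F"
    then obtain p t where pt: "p \<in> carrier R" "t \<in> Idl A" "d e = y \<otimes> p \<oplus> t"
      using dmem R.mem_Idl_insert_iff[OF A y] by blast
    interpret I: ideal "Idl A" R by (rule R.genideal_ideal[OF A])
    have "c e = (y [^] Suc k) \<otimes> p \<oplus> (?q \<otimes> t \<oplus> s e)"
      using ds(3)[OF e] pt q y sR[OF e] I.Icarr
      by (simp add: R.r_distr R.m_assoc R.a_assoc)
    moreover have "?q \<otimes> t \<oplus> s e \<in> Idl A"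
      using pt(2) ds(2)[OF e] q by (simp add: I.I_l_closed)
    ultimately show "c e \<in> Idl (insert (y [^] Suc k) A)"
      using R.mem_Idl_insert_iff[OF A yk] pt(1) by blast
  qed
qed

text \<open>Write \<open>m = w + y^k m\<^sub>1 + z\<close> and expand \<open>m\<^sub>1\<close> once more, modulo \<open>(y, A)\<close>.\<close>

lemma spans_mod_insert_pow_Suc:
  assumes A: "A \<subseteq> carrier R" and y: "y \<in> carrier R" and E: "E \<subseteq> carrier M"
    and spk: "spans_mod R M (Idl (insert (y [^] (k::nat)) A)) E"
    and sp1: "spans_mod R M (Idl (insert y A)) E"
  shows "spans_mod R M (Idl (insert (y [^] Suc k) A)) E"
  unfolding spans_mod_def
proof
  fix m assume m: "m \<in> carrier M"
  let ?N = "ideal_smult R M (Idl A)" and ?q = "y [^] k" and ?W = "linear_span R M E"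
  have q: "?q \<in> carrier R" and yk: "y [^] Suc k \<in> carrier R" using y by simp_all
  note N = submodule_ideal_smult[OF Idl_subset_carrier[OF A]]
  note W = submodule_linear_span[OF E]
  obtain w v where wv: "w \<in> ?W" "v \<in> ideal_smult R M (Idl (insert ?q A))" "m = w \<oplus>\<^bsub>M\<^esub> v"
    using bspec[OF spk[unfolded spans_mod_def] m] by blast
  obtain m1 z where m1: "m1 \<in> carrier M" "z \<in> ?N" "v = ?q \<odot>\<^bsub>M\<^esub> m1 \<oplus>\<^bsub>M\<^esub> z"
    using mem_ideal_smult_insert_iff[OF A q, THEN iffD1, OF wv(2)] by blast
  obtain w' v' where wv': "w' \<in> ?W" "v' \<in> ideal_smult R M (Idl (insert y A))" "m1 = w' \<oplus>\<^bsub>M\<^esub> v'"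
    using bspec[OF sp1[unfolded spans_mod_def] m1(1)] by blast
  obtain m2 z' where m2: "m2 \<in> carrier M" "z' \<in> ?N" "v' = y \<odot>\<^bsub>M\<^esub> m2 \<oplus>\<^bsub>M\<^esub> z'"
    using mem_ideal_smult_insert_iff[OF A y, THEN iffD1, OF wv'(2)] by blast
  have cl: "w \<in> carrier M" "w' \<in> carrier M" "z \<in> carrier M" "z' \<in> carrier M"
    using wv(1) wv'(1) m1(2) m2(2) submoduleE(1)[OF N] submoduleE(1)[OF W] by auto
  have "m = (w \<oplus>\<^bsub>M\<^esub> ?q \<odot>\<^bsub>M\<^esub> w') \<oplus>\<^bsub>M\<^esub>
      ((y [^] Suc k) \<odot>\<^bsub>M\<^esub> m2 \<oplus>\<^bsub>M\<^esub> (?q \<odot>\<^bsub>M\<^esub> z' \<oplus>\<^bsub>M\<^esub> z))"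
    unfolding wv(3) m1(3) wv'(3) m2(3) using m2(1) cl q y by (simp add: smult_r_distr smult_assoc1 M.a_ac)
  moreover have "w \<oplus>\<^bsub>M\<^esub> ?q \<odot>\<^bsub>M\<^esub> w' \<in> ?W"
    using submoduleE(4,5)[OF W] wv(1) wv'(1) q by simp
  moreover have "?q \<odot>\<^bsub>M\<^esub> z' \<oplus>\<^bsub>M\<^esub> z \<in> ?N"
    using submoduleE(4,5)[OF N] m1(2) m2(2) q by simp
  ultimately show "\<exists>w \<in> ?W. \<exists>z \<in> ideal_smult R M (Idl (insert (y [^] Suc k) A)). m = w \<oplus>\<^bsub>M\<^esub> z"
    using mem_ideal_smult_insert_iff[OF A yk] m2(1) by blast
qed

end

section \<open>Local rings and systems of parameters\<close>

lemma (in noetherian_ring) proper_ideal_subset_maximalideal: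
  assumes I: "ideal I R" "I \<noteq> carrier R"
  obtains J where "maximalideal J R" "I \<subseteq> J"
proof -
  let ?P = "{J. ideal J R \<and> I \<subseteq> J \<and> J \<noteq> carrier R}"
  have "\<exists>J\<in>?P. \<forall>Y\<in>?P. J \<subseteq> Y \<longrightarrow> Y = J"
  proof (rule subset_Zorn_nonempty)
    show "?P \<noteq> {}" using I by blast
    fix C assume C: "C \<noteq> {}" "subset.chain ?P C"
    then have "subset.chain {I. ideal I R} C"
      unfolding pred_on.chain_def by blast
    then have "\<Union>C \<in> C" using ideal_chain_is_trivial C(1) by blast
    then show "\<Union>C \<in> ?P" using C(2) unfolding pred_on.chain_def by blast
  qed
  then obtain J where JP: "J \<in> ?P" and max': "\<forall>Y\<in>?P. J \<subseteq> Y \<longrightarrow> Y = J"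
    by (rule bexE)
  then have J: "ideal J R" "I \<subseteq> J" "J \<noteq> carrier R" by simp_all
  have max: "Y = J" if "Y \<in> ?P" "J \<subseteq> Y" for Y
    using max' that by (elim ballE[of _ _ Y]) simp_all
  have "maximalideal J R"
  proof (rule maximalidealI)
    show "Y = J \<or> Y = carrier R" if "ideal Y R" "J \<subseteq> Y" for Y
      using max[of Y] that J by blast
  qed (use J in auto)
  then show thesis using that J by blast
qed

lemma (in noetherian_local_ring) Units_if_not_in_maximal:
  assumes r: "r \<in> carrier R" "r \<notin> \<mm>"
  shows "r \<in> Units R"
proof (rule ccontr)
  assume nu: "r \<notin> Units R"
  have "PIdl r \<noteq> carrier R"
  proof
    assume "PIdl r = carrier R"
    then have "\<one> \<in> PIdl r" by simp
    then obtain x where x: "x \<in> carrier R" "\<one> = x \<otimes> r" unfolding cgenideal_def by blast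
    then have "r \<otimes> x = \<one>" "x \<otimes> r = \<one>" using r(1) by (simp_all add: m_comm)
    then have "r \<in> Units R" unfolding Units_def using r(1) x(1) by blast
    with nu show False ..
  qed
  then obtain J where "maximalideal J R" "PIdl r \<subseteq> J"
    using proper_ideal_subset_maximalideal[OF cgenideal_ideal[OF r(1)]] by blast
  then show False using maximal_unique cgenideal_self[OF r(1)] r(2) by blast
qed

text \<open>The case \<open>i = j = 0\<close> shows that the radical of an ideal is closed under addition. The extra
  factors \<open>a^i b^j\<close> replace the binomial theorem: each factor \<open>a + b\<close> is split off and distributed.\<close>

lemma (in cring) radical_add_aux:
  assumes "ideal I R" and ab: "a \<in> carrier R" "b \<in> carrier R"
    and p: "a [^] (p::nat) \<in> I" and q: "b [^] (q::nat) \<in> I"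
  shows "p + q \<le> i + j + k \<Longrightarrow> a [^] i \<otimes> b [^] j \<otimes> (a \<oplus> b) [^] (k::nat) \<in> I"
proof (induction k arbitrary: i j)
  case 0
  interpret ideal I R by fact
  from 0 consider "p \<le> i" | "q \<le> j" by linarith
  then have "a [^] i \<otimes> b [^] j \<in> I"
  proof cases
    case 1
    then have "a [^] i = a [^] p \<otimes> a [^] (i - p)" using ab by (simp add: nat_pow_mult)
    then have "a [^] i \<in> I" using p ab by (simp add: I_r_closed)
    then show ?thesis using ab by (simp add: I_r_closed)
  next
    case 2
    then have "b [^] j = b [^] q \<otimes> b [^] (j - q)" using ab by (simp add: nat_pow_mult)
    then have "b [^] j \<in> I" using q ab by (simp add: I_r_closed)
    then show ?thesis using ab by (simp add: I_l_closed)
  qed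
  then show ?case using Icarr by simp
next
  case (Suc k)
  interpret ideal I R by fact
  \<comment> \<open>Each summand has total degree \<open>i + j + k + 1\<close> but only \<open>k\<close> factors \<open>a + b\<close>.\<close>
  have "a [^] i \<otimes> b [^] j \<otimes> (a \<oplus> b) [^] Suc k =
      a [^] Suc i \<otimes> b [^] j \<otimes> (a \<oplus> b) [^] k \<oplus> a [^] i \<otimes> b [^] Suc j \<otimes> (a \<oplus> b) [^] k"
    using ab by (simp add: l_distr r_distr m_ac)
  then show ?case
    using Suc.IH[of "Suc i" j] Suc.IH[of i "Suc j"] Suc.prems by simp
qed

lemma (in cring) ideal_radical:
  assumes I: "ideal I R"
  shows "ideal {r \<in> carrier R. \<exists>n::nat. r [^] n \<in> I} R"
proof (rule idealI)
  interpret I: ideal I R by fact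
  let ?J = "{r \<in> carrier R. \<exists>n::nat. r [^] n \<in> I}"
  have mult: "r \<otimes> a \<in> ?J" if "a \<in> ?J" "r \<in> carrier R" for a r
    using that by (auto simp: nat_pow_distrib intro: I.I_l_closed)
  show "ring R" by (rule ring_axioms)
  show "subgroup ?J (add_monoid R)"
  proof (rule add.subgroupI)
    have "\<zero> [^] (1::nat) \<in> I" by simp
    then show "?J \<noteq> {}" by blast
    show "\<ominus> a \<in> ?J" if "a \<in> ?J" for a
      using mult[OF that, of "\<ominus> \<one>"] that by (simp add: l_minus)
    show "a \<oplus> b \<in> ?J" if ab: "a \<in> ?J" "b \<in> ?J" for a b
    proof -
      obtain p q :: nat where "a [^] p \<in> I" "b [^] q \<in> I" using ab by blast
      then have "a [^] (0::nat) \<otimes> b [^] (0::nat) \<otimes> (a \<oplus> b) [^] (p + q) \<in> I"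
        using ab by (intro radical_add_aux[OF I]) auto
      then show ?thesis using ab by auto
    qed
  qed auto
  fix a r assume "a \<in> ?J" "r \<in> carrier R"
  then show "r \<otimes> a \<in> ?J" "a \<otimes> r \<in> ?J" using mult[of a r] m_comm[of a r] by auto
qed

text \<open>The element \<open>x\<close> itself is put last, since the regularity of a sequence says of its last member that it
  is a nonzerodivisor modulo all the others.\<close>

lemma (in noetherian_local_ring) system_of_parameters_powers:
  assumes S: "finite S" "S \<subseteq> carrier R" "Idl S = \<mm>" "enat (card S) = krull_dim R"
    and a: "\<And>s. a s > 0" and x: "x \<in> S"
  shows "\<exists>ys. set ys = (\<lambda>s. s [^] (a s :: nat)) ` (S - {x}) \<and> system_of_parameters R \<mm> (ys @ [x])"
proof -
  have "finite (S - {x})" using S(1) by simp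
  then obtain zs where zs: "set zs = S - {x}" "distinct zs"
    using finite_distinct_list by blast
  let ?ys = "map (\<lambda>s. s [^] a s) zs"
  let ?I = "Idl (set (?ys @ [x]))"
  have Sm: "S \<subseteq> \<mm>" using genideal_self[OF S(2)] S(3) by simp
  have pow_m: "s [^] n \<in> \<mm>" if "s \<in> \<mm>" "n > 0" for s and n :: nat
    using that Icarr by (cases n) (auto intro: I_l_closed)
  have sub: "set (?ys @ [x]) \<subseteq> \<mm>" using zs Sm a x pow_m by auto
  have subR: "set (?ys @ [x]) \<subseteq> carrier R" using sub Icarr by blast
  interpret I: ideal ?I R by (rule genideal_ideal[OF subR])
  let ?J = "{r \<in> carrier R. \<exists>n::nat. r [^] n \<in> ?I}"
  have "?J \<subseteq> \<mm>"
  proof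
    fix r assume "r \<in> ?J"
    then obtain n :: nat where r: "r \<in> carrier R" "r [^] n \<in> ?I" by blast
    have "?I \<subseteq> \<mm>" using sub by (intro genideal_minimal is_ideal)
    with r have "r [^] n \<in> \<mm>" by blast
    show "r \<in> \<mm>"
    proof (rule ccontr)
      assume "r \<notin> \<mm>"
      then have "r \<in> Units R" using Units_if_not_in_maximal r(1) by blast
      then have "r [^] n \<in> Units R" by (induction n) auto
      then have "\<one> \<in> \<mm>" using \<open>r [^] n \<in> \<mm>\<close> I_l_closed Units_l_inv
        by (metis Units_inv_closed)
      then show False using one_imp_carrier I_notcarr by blast
    qed
  qed
  moreover have "\<mm> \<subseteq> ?J"
  proof -
    have "S \<subseteq> ?J"
    proof
      fix s assume s: "s \<in> S"
      \<comment> \<open>The member \<open>x\<close> occurs in the list with exponent \<open>1\<close>, not \<open>a x\<close>.\<close>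
      have "s [^] (if s = x then 1 else a s) \<in> set (?ys @ [x])"
        using s zs S(2) by auto
      then show "s \<in> ?J" using s S(2) genideal_self[OF subR] by blast
    qed
    then have "Idl S \<subseteq> ?J"
      by (rule genideal_minimal[OF ideal_radical[OF I.is_ideal]])
    then show ?thesis unfolding S(3) .
  qed
  ultimately have "?J = \<mm>" by (rule equalityI)
  moreover have "length (?ys @ [x]) = card S"
    using zs x S(1) distinct_card[OF zs(2)] card_Suc_Diff1[OF S(1) x] by simp
  ultimately have "system_of_parameters R \<mm> (?ys @ [x])"
    unfolding system_of_parameters_def using S(4) sub by metis
  moreover have "set ?ys = (\<lambda>s. s [^] a s) ` (S - {x})" using zs(1) by simp
  ultimately show ?thesis by blast
qed

context module begin

lemma submodule_zero: "submodule N R M \<Longrightarrow> \<zero>\<^bsub>M\<^esub> \<in> N"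
  using subgroup.one_closed[OF submodule.axioms(1)] by fastforce

text \<open>When \<open>I\<close> is the maximal ideal of a local ring, this extends \<open>u\<close> to a lift of a basis of the vector space
  \<open>M/IM\<close>: by Zorn's lemma there is a maximal independent family containing \<open>u\<close>, and in a relation that
  shows the dependence of a further element \<open>m\<close>, the coefficient of \<open>m\<close> is a unit, so that one can
  solve for \<open>m\<close>.\<close>

lemma exists_basis_mod:
  assumes I: "ideal I R" and units: "\<And>r. r \<in> carrier R \<Longrightarrow> r \<notin> I \<Longrightarrow> r \<in> Units R"
    and u: "u \<in> carrier M" "u \<notin> ideal_smult R M I"
  obtains E where "u \<in> E" "E \<subseteq> carrier M" "independent_mod R M I E" "spans_mod R M I E"
proof -
  interpret I: ideal I R by (rule I)
  let ?N = "ideal_smult R M I"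
  have N: "submodule ?N R M" by (rule submodule_ideal_smult) (use I.Icarr in blast)
  have unit_cancel: "m \<in> ?N" if "r \<in> Units R" "m \<in> carrier M" "r \<odot>\<^bsub>M\<^esub> m \<in> ?N" for r m
  proof -
    have "m = inv r \<odot>\<^bsub>M\<^esub> (r \<odot>\<^bsub>M\<^esub> m)"
      using that by (simp add: smult_assoc1[symmetric] R.Units_closed)
    then show ?thesis using submoduleE(4)[OF N _ that(3), of "inv r"] that(1) by simp
  qed
  let ?P = "{E. u \<in> E \<and> E \<subseteq> carrier M \<and> independent_mod R M I E}"
  have "\<exists>E\<in>?P. \<forall>Y\<in>?P. E \<subseteq> Y \<longrightarrow> Y = E"
  proof (rule subset_Zorn_nonempty)
    have "independent_mod R M I {u}"
      unfolding independent_mod_def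
    proof (intro allI impI)
      fix F c assume F: "finite F" "F \<subseteq> {u}" "c \<in> F \<rightarrow> carrier R"
        "(\<Oplus>\<^bsub>M\<^esub>e\<in>F. c e \<odot>\<^bsub>M\<^esub> e) \<in> ?N"
      show "c ` F \<subseteq> I"
      proof (cases "F = {}")
        case False
        then have [simp]: "F = {u}" using F(2) by blast
        have "c u \<odot>\<^bsub>M\<^esub> u \<in> ?N" using F(3,4) u(1) by simp
        then have "c u \<in> I" using units[of "c u"] unit_cancel[of "c u" u] u F(3) by auto
        then show ?thesis by simp
      qed simp
    qed
    then show "?P \<noteq> {}" using u(1) by blast
    fix C assume C: "C \<noteq> {}" "subset.chain ?P C"
    then have CP: "\<And>E. E \<in> C \<Longrightarrow> E \<in> ?P" unfolding pred_on.chain_def by blast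
    have "independent_mod R M I (\<Union>C)"
      unfolding independent_mod_def
    proof (intro allI impI)
      fix F c assume F: "finite F" "F \<subseteq> \<Union>C" "c \<in> F \<rightarrow> carrier R"
        "(\<Oplus>\<^bsub>M\<^esub>e\<in>F. c e \<odot>\<^bsub>M\<^esub> e) \<in> ?N"
      obtain E where "E \<in> C" "F \<subseteq> E"
        using finite_subset_Union_chain[OF F(1,2) C] by blast
      then show "c ` F \<subseteq> I" using F CP[of E] unfolding independent_mod_def by blast
    qed
    then show "\<Union>C \<in> ?P" using CP C(1) by blast
  qed
  then obtain E where EP: "E \<in> ?P" and max': "\<forall>Y\<in>?P. E \<subseteq> Y \<longrightarrow> Y = E"
    by (rule bexE)
  then have E: "u \<in> E" "E \<subseteq> carrier M" "independent_mod R M I E" by simp_all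
  have max: "Y = E" if "Y \<in> ?P" "E \<subseteq> Y" for Y
    using max' that by (elim ballE[of _ _ Y]) simp_all
  let ?W = "linear_span R M E"
  note W = submodule_linear_span[OF E(2)]
  have "spans_mod R M I E"
    unfolding spans_mod_def
  proof
    fix m assume m: "m \<in> carrier M"
    show "\<exists>w\<in>?W. \<exists>z\<in>?N. m = w \<oplus>\<^bsub>M\<^esub> z"
    proof (cases "m \<in> E")
      case True
      have "m = m \<oplus>\<^bsub>M\<^esub> \<zero>\<^bsub>M\<^esub>" using m by simp
      then show ?thesis using mem_linear_span[OF True E(2)] submodule_zero[OF N] by blast
    next
      case False
      then have "\<not> independent_mod R M I (insert m E)"
        using max[of "insert m E"] E m by blast
      then obtain F c where F: "finite F" "F \<subseteq> insert m E" "c \<in> F \<rightarrow> carrier R"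
        and mem: "(\<Oplus>\<^bsub>M\<^esub>e\<in>F. c e \<odot>\<^bsub>M\<^esub> e) \<in> ?N" and nsub: "\<not> c ` F \<subseteq> I"
        unfolding independent_mod_def by blast
      define G where "G = F - {m}"
      have G: "finite G" "G \<subseteq> E" "c \<in> G \<rightarrow> carrier R" "m \<notin> G" "G \<subseteq> carrier M"
        using F E by (auto simp: G_def)
      have "m \<in> F"
      proof (rule ccontr)
        assume "m \<notin> F"
        then have "F \<subseteq> E" using F(2) by blast
        then show False using E(3) F mem nsub unfolding independent_mod_def by blast
      qed
      then have FG: "F = insert m G" and cm: "c m \<in> carrier R" using F by (auto simp: G_def)
      define s where "s = (\<Oplus>\<^bsub>M\<^esub>e\<in>G. c e \<odot>\<^bsub>M\<^esub> e)"
      have sW: "s \<in> ?W" unfolding s_def using G by (intro linear_spanI)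
      have s: "s \<in> carrier M" using sW submoduleE(1)[OF W] by blast
      have fc: "(\<lambda>e. c e \<odot>\<^bsub>M\<^esub> e) \<in> G \<rightarrow> carrier M"
        using G(3,5) by (auto intro!: smult_closed)
      have sum: "(\<Oplus>\<^bsub>M\<^esub>e\<in>F. c e \<odot>\<^bsub>M\<^esub> e) = c m \<odot>\<^bsub>M\<^esub> m \<oplus>\<^bsub>M\<^esub> s"
        unfolding FG s_def using G fc m cm by (simp add: M.finsum_insert)
      have "c m \<notin> I"
      proof
        assume "c m \<in> I"
        then have cN: "c m \<odot>\<^bsub>M\<^esub> m \<in> ?N" using m by (rule smult_mem_ideal_smult)
        have eq: "\<ominus>\<^bsub>M\<^esub> (c m \<odot>\<^bsub>M\<^esub> m) \<oplus>\<^bsub>M\<^esub> (c m \<odot>\<^bsub>M\<^esub> m \<oplus>\<^bsub>M\<^esub> s) = s"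
          using s cm m by (simp add: M.r_neg1)
        have "s \<in> ?N"
          using submoduleE(5)[OF N submoduleE(3)[OF N cN] mem] unfolding sum eq .
        then have "c ` G \<subseteq> I" using E(3) G unfolding independent_mod_def s_def by blast
        then show False using nsub \<open>c m \<in> I\<close> FG by blast
      qed
      then have cU: "c m \<in> Units R" using units cm by blast
      define v where "v = inv (c m)"
      have v: "v \<in> carrier R" using cU by (simp add: v_def)
      let ?t = "c m \<odot>\<^bsub>M\<^esub> m \<oplus>\<^bsub>M\<^esub> s"
      have "m = v \<odot>\<^bsub>M\<^esub> (c m \<odot>\<^bsub>M\<^esub> m)"
        using m cm v cU by (simp add: smult_assoc1[symmetric] v_def)
      also have "c m \<odot>\<^bsub>M\<^esub> m = \<ominus>\<^bsub>M\<^esub> s \<oplus>\<^bsub>M\<^esub> ?t"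
        using s cm m by (simp add: M.a_comm[of "c m \<odot>\<^bsub>M\<^esub> m" s] M.r_neg1)
      also have "v \<odot>\<^bsub>M\<^esub> \<dots> = v \<odot>\<^bsub>M\<^esub> (\<ominus>\<^bsub>M\<^esub> s) \<oplus>\<^bsub>M\<^esub> v \<odot>\<^bsub>M\<^esub> ?t"
        using s cm m v by (intro smult_r_distr) simp_all
      finally have "m = v \<odot>\<^bsub>M\<^esub> (\<ominus>\<^bsub>M\<^esub> s) \<oplus>\<^bsub>M\<^esub> v \<odot>\<^bsub>M\<^esub> ?t" .
      moreover have "v \<odot>\<^bsub>M\<^esub> (\<ominus>\<^bsub>M\<^esub> s) \<in> ?W"
        by (rule submoduleE(4)[OF W v submoduleE(3)[OF W sW]])
      moreover have "v \<odot>\<^bsub>M\<^esub> ?t \<in> ?N"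
        using submoduleE(4)[OF N v mem] sum by simp
      ultimately show ?thesis by blast
    qed
  qed
  then show thesis using that E by blast
qed

text \<open>Induction on the sum of the exponents: if some \<open>a x = k + 1\<close> with \<open>k > 0\<close>, then lowering the exponent
  of \<open>x\<close> to \<open>k\<close> and to \<open>1\<close> gives the two cases from which the step lemmas reach \<open>k + 1\<close>.\<close>

lemma basis_mod_powers:
  assumes S: "finite S" "S \<subseteq> carrier R" and E: "E \<subseteq> carrier M"
    and reg: "\<And>x a b. x \<in> S \<Longrightarrow> (\<And>s. a s > 0) \<Longrightarrow> b \<in> carrier M \<Longrightarrow>
      x \<odot>\<^bsub>M\<^esub> b \<in> ideal_smult R M (Idl ((\<lambda>s. s [^] (a s :: nat)) ` (S - {x}))) \<Longrightarrow>
      b \<in> ideal_smult R M (Idl ((\<lambda>s. s [^] a s) ` (S - {x})))"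
    and ind: "independent_mod R M (Idl S) E" and sp: "spans_mod R M (Idl S) E"
  shows "(\<And>s. a s > 0) \<Longrightarrow>
    independent_mod R M (Idl ((\<lambda>s. s [^] (a s :: nat)) ` S)) E \<and>
    spans_mod R M (Idl ((\<lambda>s. s [^] a s) ` S)) E"
proof (induction "sum a S" arbitrary: a rule: less_induct)
  case less
  show ?case
  proof (cases "\<forall>s\<in>S. a s = 1")
    case True
    then have "(\<lambda>s. s [^] a s) ` S = (\<lambda>s. s) ` S"
      using S(2) by (intro image_cong) (auto simp: subset_iff)
    then show ?thesis using ind sp by simp
  next
    case False
    then obtain x where x: "x \<in> S" "a x \<noteq> 1" by blast
    then obtain k where k: "a x = Suc k" "k > 0"
      using less.prems[of x] by (cases "a x") auto
    let ?A = "(\<lambda>s. s [^] a s) ` (S - {x})"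
    have xR: "x \<in> carrier R" and A: "?A \<subseteq> carrier R" using x S(2) by auto
    \<comment> \<open>The set \<open>A\<close> does not involve the exponent of \<open>x\<close>, so it is common to all the cases below.\<close>
    have split: "(\<lambda>s. s [^] (a(x := j)) s) ` S = insert (x [^] j) ?A" for j
    proof -
      have "(\<lambda>s. s [^] (a(x := j)) s) ` S = (\<lambda>s. s [^] (a(x := j)) s) ` insert x (S - {x})"
        using x(1) by (simp add: insert_absorb)
      also have "\<dots> = insert (x [^] j) ?A" by auto
      finally show ?thesis .
    qed
    have smaller: "sum (a(x := j)) S < sum a S" if "j \<le> k" for j
      using S(1) x(1) that k(1) by (intro sum_strict_mono_ex1) auto
    have IH: "independent_mod R M (Idl (insert (x [^] j) ?A)) E \<and>
        spans_mod R M (Idl (insert (x [^] j) ?A)) E" if "j \<le> k" "j > 0" for j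
      using less.hyps[of "a(x := j)", OF smaller[OF that(1)]] less.prems that(2)
      unfolding split by simp
    have regx: "b \<in> ideal_smult R M (Idl ?A)"
      if "b \<in> carrier M" "x \<odot>\<^bsub>M\<^esub> b \<in> ideal_smult R M (Idl ?A)" for b
      using reg[OF x(1) less.prems that] .
    have IH1: "independent_mod R M (Idl (insert x ?A)) E"  "spans_mod R M (Idl (insert x ?A)) E"
      using IH[of 1] k(2) xR by simp_all
    have eq: "(\<lambda>s. s [^] a s) ` S = insert (x [^] Suc k) ?A"
      using split[of "Suc k"] unfolding k(1)[symmetric] by simp
    show ?thesis
      unfolding eq
    proof
      show "independent_mod R M (Idl (insert (x [^] Suc k) ?A)) E"
        by (rule independent_mod_insert_pow_Suc[OF A xR E regx]) (use IH[of k] k(2) IH1 in auto)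
      show "spans_mod R M (Idl (insert (x [^] Suc k) ?A)) E"
        by (rule spans_mod_insert_pow_Suc[OF A xR E]) (use IH[of k] k(2) IH1 in auto)
    qed
  qed
qed

end

section \<open>Gluing coordinates along a complete filtration\<close>

text \<open>The element \<open>r\<close> is a \<open>u\<close>-coordinate of \<open>m\<close> with respect to \<open>E\<close> modulo \<open>IM\<close>. It is a relation because the
  coordinate is determined only up to \<open>I\<close>.\<close>

definition has_coefficient ::
  "('a, 'r) ring_scheme \<Rightarrow> ('a, 'b, 'm) module_scheme \<Rightarrow> 'a set \<Rightarrow> 'b set \<Rightarrow> 'b \<Rightarrow> 'b \<Rightarrow> 'a \<Rightarrow> bool" where
  "has_coefficient R M I E u m r \<longleftrightarrow> r \<in> carrier R \<and>
     (\<exists>w \<in> linear_span R M (E - {u}). \<exists>z \<in> ideal_smult R M I. m = r \<odot>\<^bsub>M\<^esub> u \<oplus>\<^bsub>M\<^esub> w \<oplus>\<^bsub>M\<^esub> z)"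

lemma (in cring) ideal_pow_is_ideal:
  assumes "ideal I R"
  shows "ideal (I [^]\<^bsub>ideals_set R\<^esub> (n::nat)) R"
proof (induction n)
  case 0
  then show ?case by (simp add: ideals_set_def oneideal)
next
  case (Suc n)
  then show ?case using ideal_prod_is_ideal[OF Suc assms] by (simp add: ideals_set_def)
qed

lemma (in cring) pow_mem_ideal_pow:
  assumes "ideal I R" "s \<in> I"
  shows "s [^] n \<in> I [^]\<^bsub>ideals_set R\<^esub> (n::nat)"
proof (induction n)
  case 0
  then show ?case by (simp add: ideals_set_def)
next
  case (Suc n)
  then show ?case using ideal_prod.prod[OF Suc assms(2)] by (simp add: ideals_set_def)
qed

lemma (in ideal) cong_sym:
  assumes "a \<ominus> b \<in> I" "a \<in> carrier R" "b \<in> carrier R"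
  shows "b \<ominus> a \<in> I"
proof -
  have "b \<ominus> a = \<ominus> (a \<ominus> b)" using assms(2,3) by (simp add: minus_eq minus_add a_comm)
  then show ?thesis using additive_subgroup.a_inv_closed[OF is_additive_subgroup assms(1)] by simp
qed

lemma (in ideal) cong_trans:
  assumes "a \<ominus> b \<in> I" "b \<ominus> c \<in> I" "a \<in> carrier R" "b \<in> carrier R" "c \<in> carrier R"
  shows "a \<ominus> c \<in> I"
proof -
  have "a \<ominus> c = (a \<ominus> b) \<oplus> (b \<ominus> c)"
    using assms(3-5) by (simp add: minus_eq a_assoc r_neg1)
  then show ?thesis using additive_subgroup.a_closed[OF is_additive_subgroup assms(1,2)] by simp
qed

lemma (in ideal) cong_add:
  assumes "a \<ominus> b \<in> I" "c \<ominus> d \<in> I"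
    "a \<in> carrier R" "b \<in> carrier R" "c \<in> carrier R" "d \<in> carrier R"
  shows "(a \<oplus> c) \<ominus> (b \<oplus> d) \<in> I"
proof -
  have "(a \<oplus> c) \<ominus> (b \<oplus> d) = (a \<ominus> b) \<oplus> (c \<ominus> d)"
    using assms(3-6) by (simp add: minus_eq minus_add a_ac)
  then show ?thesis using additive_subgroup.a_closed[OF is_additive_subgroup assms(1,2)] by simp
qed

lemma (in ideal) cong_mult:
  assumes "a \<ominus> b \<in> I" "a \<in> carrier R" "b \<in> carrier R" "r \<in> carrier R"
  shows "(r \<otimes> a) \<ominus> (r \<otimes> b) \<in> I"
proof -
  have "(r \<otimes> a) \<ominus> (r \<otimes> b) = r \<otimes> (a \<ominus> b)"
    using assms(2-4) by (simp add: minus_eq r_distr r_minus)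
  then show ?thesis using I_l_closed[OF assms(1,4)] by simp
qed

context module begin

lemma ideal_smult_mono: "I \<subseteq> J \<Longrightarrow> ideal_smult R M I \<subseteq> ideal_smult R M J"
  unfolding ideal_smult_def by blast

lemma has_coefficient_exists:
  assumes sp: "spans_mod R M I E" and E: "E \<subseteq> carrier M" and u: "u \<in> E" and m: "m \<in> carrier M"
  shows "\<exists>r. has_coefficient R M I E u m r"
proof -
  obtain v z where v: "v \<in> linear_span R M E" and z: "z \<in> ideal_smult R M I" "m = v \<oplus>\<^bsub>M\<^esub> z"
    using bspec[OF sp[unfolded spans_mod_def] m] by blast
  obtain c F where F: "finite F" "F \<subseteq> E" "c \<in> F \<rightarrow> carrier R"
    and v_eq: "v = (\<Oplus>\<^bsub>M\<^esub>e\<in>F. c e \<odot>\<^bsub>M\<^esub> e)"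
    using v unfolding linear_span_def by blast
  define c' where "c' = (\<lambda>e. if e \<in> F then c e else \<zero>)"
  have c': "c' e \<in> carrier R" for e using F(3) by (auto simp: c'_def)
  have "v = (\<Oplus>\<^bsub>M\<^esub>e\<in>insert u F. c' e \<odot>\<^bsub>M\<^esub> e)"
    unfolding v_eq c'_def using F E u by (intro finsum_smult_extend) auto
  also have "\<dots> = (\<Oplus>\<^bsub>M\<^esub>e\<in>insert u (F - {u}). c' e \<odot>\<^bsub>M\<^esub> e)" by simp
  also have "\<dots> = c' u \<odot>\<^bsub>M\<^esub> u \<oplus>\<^bsub>M\<^esub> (\<Oplus>\<^bsub>M\<^esub>e\<in>F - {u}. c' e \<odot>\<^bsub>M\<^esub> e)"
    using F(1,2) E u c' by (intro M.finsum_insert) (auto intro!: smult_closed)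
  finally have "m = c' u \<odot>\<^bsub>M\<^esub> u \<oplus>\<^bsub>M\<^esub> (\<Oplus>\<^bsub>M\<^esub>e\<in>F - {u}. c' e \<odot>\<^bsub>M\<^esub> e) \<oplus>\<^bsub>M\<^esub> z" using z(2) by simp
  moreover have "(\<Oplus>\<^bsub>M\<^esub>e\<in>F - {u}. c' e \<odot>\<^bsub>M\<^esub> e) \<in> linear_span R M (E - {u})"
    using F(1,2) c' by (intro linear_spanI) auto
  ultimately show ?thesis unfolding has_coefficient_def using z(1) c'[of u] by blast
qed

lemma has_coefficient_zero:
  assumes ind: "independent_mod R M I E" and I: "I \<subseteq> carrier R"
    and E: "E \<subseteq> carrier M" and u: "u \<in> E"
    and r: "has_coefficient R M I E u \<zero>\<^bsub>M\<^esub> r"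
  shows "r \<in> I"
proof -
  note N = submodule_ideal_smult[OF I]
  obtain w z where rR: "r \<in> carrier R" and w: "w \<in> linear_span R M (E - {u})"
    and z: "z \<in> ideal_smult R M I" and eq: "\<zero>\<^bsub>M\<^esub> = r \<odot>\<^bsub>M\<^esub> u \<oplus>\<^bsub>M\<^esub> w \<oplus>\<^bsub>M\<^esub> z"
    using r unfolding has_coefficient_def by blast
  obtain c F where F: "finite F" "F \<subseteq> E - {u}" "c \<in> F \<rightarrow> carrier R"
    and w_eq: "w = (\<Oplus>\<^bsub>M\<^esub>e\<in>F. c e \<odot>\<^bsub>M\<^esub> e)"
    using w unfolding linear_span_def by blast
  have uM: "u \<in> carrier M" "u \<notin> F" "F \<subseteq> carrier M" using u E F(2) by auto
  \<comment> \<open>The relation \<open>r u + w \<in> IM\<close> is one relation on \<open>E\<close> because \<open>w\<close> does not involve \<open>u\<close>.\<close>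
  define c' where "c' = c(u := r)"
  have c': "c' \<in> insert u F \<rightarrow> carrier R" using F(3) rR by (auto simp: c'_def)
  have fc: "(\<lambda>e. c' e \<odot>\<^bsub>M\<^esub> e) \<in> F \<rightarrow> carrier M" using c' uM(3) by (auto intro!: smult_closed)
  have wM: "w \<in> carrier M" "z \<in> carrier M"
    using w submoduleE(1)[OF submodule_linear_span[of "E - {u}"]] z submoduleE(1)[OF N] E by blast+
  have "(\<Oplus>\<^bsub>M\<^esub>e\<in>F. c' e \<odot>\<^bsub>M\<^esub> e) = w"
    unfolding w_eq using uM F(3) by (intro M.finsum_cong') (auto simp: c'_def intro!: smult_closed)
  then have sum: "(\<Oplus>\<^bsub>M\<^esub>e\<in>insert u F. c' e \<odot>\<^bsub>M\<^esub> e) = r \<odot>\<^bsub>M\<^esub> u \<oplus>\<^bsub>M\<^esub> w"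
    using M.finsum_insert[OF F(1) uM(2) fc] uM(1) rR by (simp add: c'_def)
  have "r \<odot>\<^bsub>M\<^esub> u \<oplus>\<^bsub>M\<^esub> w = \<ominus>\<^bsub>M\<^esub> z"
    using eq rR uM(1) wM by (metis M.minus_equality M.add.m_closed M.minus_minus smult_closed M.a_comm)
  then have "(\<Oplus>\<^bsub>M\<^esub>e\<in>insert u F. c' e \<odot>\<^bsub>M\<^esub> e) \<in> ideal_smult R M I"
    using sum submoduleE(3)[OF N z] by simp
  moreover have "insert u F \<subseteq> E" "finite (insert u F)" using F u by auto
  ultimately have "c' ` insert u F \<subseteq> I"
    using ind c' unfolding independent_mod_def by blast
  then show ?thesis by (simp add: c'_def)
qed

lemma has_coefficient_add:
  assumes I: "I \<subseteq> carrier R" and E: "E \<subseteq> carrier M" and u: "u \<in> E"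
    and r: "has_coefficient R M I E u m r" "has_coefficient R M I E u m' r'"
  shows "has_coefficient R M I E u (m \<oplus>\<^bsub>M\<^esub> m') (r \<oplus> r')"
proof -
  note N = submodule_ideal_smult[OF I]
  have W: "submodule (linear_span R M (E - {u})) R M" using E by (intro submodule_linear_span) auto
  obtain w z where 1: "r \<in> carrier R" "w \<in> linear_span R M (E - {u})"
    "z \<in> ideal_smult R M I" "m = r \<odot>\<^bsub>M\<^esub> u \<oplus>\<^bsub>M\<^esub> w \<oplus>\<^bsub>M\<^esub> z"
    using r(1) unfolding has_coefficient_def by blast
  obtain w' z' where 2: "r' \<in> carrier R" "w' \<in> linear_span R M (E - {u})"
    "z' \<in> ideal_smult R M I" "m' = r' \<odot>\<^bsub>M\<^esub> u \<oplus>\<^bsub>M\<^esub> w' \<oplus>\<^bsub>M\<^esub> z'"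
    using r(2) unfolding has_coefficient_def by blast
  have cl: "w \<in> carrier M" "w' \<in> carrier M" "z \<in> carrier M" "z' \<in> carrier M" "u \<in> carrier M"
    using 1(2,3) 2(2,3) submoduleE(1)[OF N] submoduleE(1)[OF W] u E by auto
  have "m \<oplus>\<^bsub>M\<^esub> m' = (r \<oplus> r') \<odot>\<^bsub>M\<^esub> u \<oplus>\<^bsub>M\<^esub> (w \<oplus>\<^bsub>M\<^esub> w') \<oplus>\<^bsub>M\<^esub> (z \<oplus>\<^bsub>M\<^esub> z')"
    unfolding 1(4) 2(4) using 1(1) 2(1) cl by (simp add: smult_l_distr M.a_ac)
  moreover have "w \<oplus>\<^bsub>M\<^esub> w' \<in> linear_span R M (E - {u})" by (rule submoduleE(5)[OF W 1(2) 2(2)])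
  moreover have "z \<oplus>\<^bsub>M\<^esub> z' \<in> ideal_smult R M I" by (rule submoduleE(5)[OF N 1(3) 2(3)])
  ultimately show ?thesis unfolding has_coefficient_def using R.add.m_closed[OF 1(1) 2(1)] by blast
qed

lemma has_coefficient_smult:
  assumes I: "I \<subseteq> carrier R" and E: "E \<subseteq> carrier M" and u: "u \<in> E" and a: "a \<in> carrier R"
    and r: "has_coefficient R M I E u m r"
  shows "has_coefficient R M I E u (a \<odot>\<^bsub>M\<^esub> m) (a \<otimes> r)"
proof -
  note N = submodule_ideal_smult[OF I]
  have W: "submodule (linear_span R M (E - {u})) R M" using E by (intro submodule_linear_span) auto
  obtain w z where 1: "r \<in> carrier R" "w \<in> linear_span R M (E - {u})"
    "z \<in> ideal_smult R M I" "m = r \<odot>\<^bsub>M\<^esub> u \<oplus>\<^bsub>M\<^esub> w \<oplus>\<^bsub>M\<^esub> z"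
    using r unfolding has_coefficient_def by blast
  have cl: "w \<in> carrier M" "z \<in> carrier M" "u \<in> carrier M"
    using 1(2,3) submoduleE(1)[OF N] submoduleE(1)[OF W] u E by auto
  have "a \<odot>\<^bsub>M\<^esub> m = (a \<otimes> r) \<odot>\<^bsub>M\<^esub> u \<oplus>\<^bsub>M\<^esub> a \<odot>\<^bsub>M\<^esub> w \<oplus>\<^bsub>M\<^esub> a \<odot>\<^bsub>M\<^esub> z"
    unfolding 1(4) using 1(1) cl a by (simp add: smult_r_distr smult_assoc1)
  moreover have "a \<odot>\<^bsub>M\<^esub> w \<in> linear_span R M (E - {u})" by (rule submoduleE(4)[OF W a 1(2)])
  moreover have "a \<odot>\<^bsub>M\<^esub> z \<in> ideal_smult R M I" by (rule submoduleE(4)[OF N a 1(3)])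
  ultimately show ?thesis unfolding has_coefficient_def using R.m_closed[OF a 1(1)] by blast
qed

lemma has_coefficient_self:
  assumes I: "I \<subseteq> carrier R" and E: "E \<subseteq> carrier M" and u: "u \<in> E"
  shows "has_coefficient R M I E u u \<one>"
proof -
  note N = submodule_ideal_smult[OF I]
  have W: "submodule (linear_span R M (E - {u})) R M" using E by (intro submodule_linear_span) auto
  have "u = \<one> \<odot>\<^bsub>M\<^esub> u \<oplus>\<^bsub>M\<^esub> \<zero>\<^bsub>M\<^esub> \<oplus>\<^bsub>M\<^esub> \<zero>\<^bsub>M\<^esub>" using u E by (simp add: subset_iff)
  then show ?thesis
    unfolding has_coefficient_def using submodule_zero[OF N] submodule_zero[OF W] R.one_closed by blast
qed

lemma has_coefficient_unique:
  assumes ind: "independent_mod R M I E" and I: "I \<subseteq> carrier R"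
    and E: "E \<subseteq> carrier M" and u: "u \<in> E" and m: "m \<in> carrier M"
    and r: "has_coefficient R M I E u m r" "has_coefficient R M I E u m r'"
  shows "r \<ominus> r' \<in> I"
proof -
  have r': "r' \<in> carrier R" using r(2) by (simp add: has_coefficient_def)
  have "has_coefficient R M I E u (m \<oplus>\<^bsub>M\<^esub> (\<ominus> \<one>) \<odot>\<^bsub>M\<^esub> m) (r \<oplus> (\<ominus> \<one>) \<otimes> r')"
    by (intro has_coefficient_add has_coefficient_smult I E u r) simp
  moreover have "m \<oplus>\<^bsub>M\<^esub> (\<ominus> \<one>) \<odot>\<^bsub>M\<^esub> m = \<zero>\<^bsub>M\<^esub>" using m by (simp add: smult_l_minus M.r_neg)
  moreover have "r \<oplus> (\<ominus> \<one>) \<otimes> r' = r \<ominus> r'" using r' by (simp add: R.l_minus R.minus_eq)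
  ultimately show ?thesis using has_coefficient_zero[OF ind I E u] by simp
qed

lemma has_coefficient_mono:
  "I \<subseteq> J \<Longrightarrow> has_coefficient R M I E u m r \<Longrightarrow> has_coefficient R M J E u m r"
  unfolding has_coefficient_def using ideal_smult_mono[of I J] by blast

text \<open>Modulo each \<open>J n\<close> the \<open>u\<close>-coordinate of \<open>m\<close> is unique and these coordinates are compatible, so they
  converge to some \<open>\<phi> m\<close>. Since \<open>\<phi> m\<close> is congruent modulo \<open>K n\<close> to every \<open>u\<close>-coordinate of \<open>m\<close> modulo \<open>J n\<close>,
  linearity holds modulo each \<open>K n\<close>, and therefore exactly. Two filtrations are used because
  coordinates are unique modulo the ideals generated by powers of the parameters, whereas completeness is
  given for the powers of the maximal ideal, which are larger.\<close>

lemma coordinate_functional: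
  fixes J K :: "nat \<Rightarrow> 'a set"
  assumes J: "\<And>n. J n \<subseteq> carrier R" "\<And>n. J (Suc n) \<subseteq> J n" "\<And>n. J n \<subseteq> K n"
    and K: "\<And>n. ideal (K n) R"
    and separated: "(\<Inter>n. K n) = {\<zero>}"
    and complete: "\<And>x. (\<And>n. x n \<in> carrier R) \<Longrightarrow> (\<And>n. x (Suc n) \<ominus> x n \<in> K n) \<Longrightarrow>
      \<exists>y \<in> carrier R. \<forall>n. y \<ominus> x n \<in> K n"
    and E: "E \<subseteq> carrier M" and u: "u \<in> E"
    and ind: "\<And>n. independent_mod R M (J n) E" and sp: "\<And>n. spans_mod R M (J n) E"
  obtains \<phi> where "\<phi> \<in> dual_module R M" "\<phi> u = \<one>"
proof -
  let ?C = "\<lambda>n. has_coefficient R M (J n) E u"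
  have CR: "r \<in> carrier R" if "?C n m r" for n m r
    using that by (simp add: has_coefficient_def)
  have uniq: "r \<ominus> r' \<in> K n" if "m \<in> carrier M" "?C n m r" "?C n m r'" for n m r r'
    using has_coefficient_unique[OF ind J(1) E u that] J(3)[of n] by blast
  have "\<exists>y. y \<in> carrier R \<and> (\<forall>n r. ?C n m r \<longrightarrow> y \<ominus> r \<in> K n)" if m: "m \<in> carrier M" for m
  proof -
    define x where "x n = (SOME r. ?C n m r)" for n
    have x: "?C n m (x n)" for n
      unfolding x_def using has_coefficient_exists[OF sp E u m] by (rule someI_ex)
    have "x (Suc n) \<ominus> x n \<in> K n" for n
      by (rule uniq[OF m has_coefficient_mono[OF J(2) x] x])
    then obtain y where y: "y \<in> carrier R" "\<forall>n. y \<ominus> x n \<in> K n"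
      using complete[of x] CR[OF x] by blast
    have "y \<ominus> r \<in> K n" if "?C n m r" for n r
      by (rule ideal.cong_trans[OF K _ uniq[OF m x that]]) (use y CR[OF x] CR[OF that] in auto)
    then show ?thesis using y(1) by blast
  qed
  then obtain \<phi> where \<phi>: "\<And>m. m \<in> carrier M \<Longrightarrow> \<phi> m \<in> carrier R"
    and \<phi>C: "\<And>m n r. m \<in> carrier M \<Longrightarrow> ?C n m r \<Longrightarrow> \<phi> m \<ominus> r \<in> K n"
    by metis
  have eqI: "a = b" if "a \<in> carrier R" "b \<in> carrier R" "\<And>n. a \<ominus> b \<in> K n" for a b
  proof -
    have "a \<ominus> b \<in> (\<Inter>n. K n)" using that(3) by blast
    then have "a \<ominus> b = \<zero>" using separated by simp
    then show ?thesis using that(1,2) by (simp add: R.r_right_minus_eq)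
  qed
  have "\<phi> (m \<oplus>\<^bsub>M\<^esub> m') = \<phi> m \<oplus> \<phi> m'" if m: "m \<in> carrier M" "m' \<in> carrier M" for m m'
  proof (rule eqI)
    fix n
    obtain r r' where r: "?C n m r" "?C n m' r'"
      using has_coefficient_exists[OF sp E u] m by blast
    note cl = CR[OF r(1)] CR[OF r(2)] \<phi>[OF m(1)] \<phi>[OF m(2)]
    have mm: "m \<oplus>\<^bsub>M\<^esub> m' \<in> carrier M" using m by simp
    have 1: "\<phi> (m \<oplus>\<^bsub>M\<^esub> m') \<ominus> (r \<oplus> r') \<in> K n"
      by (rule \<phi>C[OF mm has_coefficient_add[OF J(1) E u r]])
    have "(\<phi> m \<oplus> \<phi> m') \<ominus> (r \<oplus> r') \<in> K n"
      by (rule ideal.cong_add[OF K \<phi>C[OF m(1) r(1)] \<phi>C[OF m(2) r(2)]]) (use cl in simp_all)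
    then have 2: "(r \<oplus> r') \<ominus> (\<phi> m \<oplus> \<phi> m') \<in> K n"
      by (rule ideal.cong_sym[OF K]) (use cl in simp_all)
    show "\<phi> (m \<oplus>\<^bsub>M\<^esub> m') \<ominus> (\<phi> m \<oplus> \<phi> m') \<in> K n"
      by (rule ideal.cong_trans[OF K 1 2]) (use \<phi>[OF mm] cl in simp_all)
  qed (use \<phi> m in simp_all)
  moreover have "\<phi> (a \<odot>\<^bsub>M\<^esub> m) = a \<otimes> \<phi> m" if m: "a \<in> carrier R" "m \<in> carrier M" for a m
  proof (rule eqI)
    fix n
    obtain r where r: "?C n m r"
      using has_coefficient_exists[OF sp E u] m by blast
    note cl = CR[OF r] \<phi>[OF m(2)] m(1)
    have am: "a \<odot>\<^bsub>M\<^esub> m \<in> carrier M" using m by simp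
    have 1: "\<phi> (a \<odot>\<^bsub>M\<^esub> m) \<ominus> (a \<otimes> r) \<in> K n"
      by (rule \<phi>C[OF am has_coefficient_smult[OF J(1) E u m(1) r]])
    have "(a \<otimes> \<phi> m) \<ominus> (a \<otimes> r) \<in> K n"
      by (rule ideal.cong_mult[OF K \<phi>C[OF m(2) r]]) (use cl in simp_all)
    then have 2: "(a \<otimes> r) \<ominus> (a \<otimes> \<phi> m) \<in> K n"
      by (rule ideal.cong_sym[OF K]) (use cl in simp_all)
    show "\<phi> (a \<odot>\<^bsub>M\<^esub> m) \<ominus> (a \<otimes> \<phi> m) \<in> K n"
      by (rule ideal.cong_trans[OF K 1 2]) (use \<phi>[OF am] cl in simp_all)
  qed (use \<phi> m in simp_all)
  moreover have "\<phi> u = \<one>"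
  proof (rule eqI)
    show "\<phi> u \<ominus> \<one> \<in> K n" for n
      using u E by (intro \<phi>C has_coefficient_self J E u) auto
  qed (use \<phi> u E in auto)
  moreover have "\<phi> \<in> carrier M \<rightarrow> carrier R" using \<phi> by blast
  ultimately show thesis using that[of \<phi>] unfolding dual_module_def by blast
qed

end

section \<open>The splitting criterion\<close>

context module begin

lemma notin_ideal_smult_if_splits:
  assumes I: "ideal I R" "\<one> \<notin> I" and u: "u \<in> carrier M" "splits R M u"
  shows "u \<notin> ideal_smult R M I"
proof
  assume mem: "u \<in> ideal_smult R M I"
  interpret I: ideal I R by (rule I)
  obtain \<phi> where \<phi>: "\<phi> \<in> dual_module R M" "\<phi> u = \<one>" using u(2) unfolding splits_def by blast
  have cl: "\<And>x. x \<in> carrier M \<Longrightarrow> \<phi> x \<in> carrier R"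
    and add: "\<And>x y. x \<in> carrier M \<Longrightarrow> y \<in> carrier M \<Longrightarrow> \<phi> (x \<oplus>\<^bsub>M\<^esub> y) = \<phi> x \<oplus> \<phi> y"
    and smult: "\<And>r x. r \<in> carrier R \<Longrightarrow> x \<in> carrier M \<Longrightarrow> \<phi> (r \<odot>\<^bsub>M\<^esub> x) = r \<otimes> \<phi> x"
    using \<phi>(1) unfolding dual_module_def by auto
  let ?N = "{x \<in> carrier M. \<phi> x \<in> I}"
  have "submodule ?N R M"
  proof (rule submoduleI)
    have "\<phi> \<zero>\<^bsub>M\<^esub> = \<zero>" using smult[of \<zero> "\<zero>\<^bsub>M\<^esub>"] cl[of "\<zero>\<^bsub>M\<^esub>"] by simp
    then show "\<zero>\<^bsub>M\<^esub> \<in> ?N" by simp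
    show sm: "a \<odot>\<^bsub>M\<^esub> x \<in> ?N" if "a \<in> carrier R" "x \<in> ?N" for a x
      using that smult I.I_l_closed by simp
    show "\<ominus>\<^bsub>M\<^esub> x \<in> ?N" if "x \<in> ?N" for x
      using sm[of "\<ominus> \<one>" x] that by (simp add: smult_l_minus)
  qed (use add in auto)
  then have "ideal_smult R M I \<subseteq> ?N"
    using cl I.Icarr I.I_r_closed smult by (intro ideal_smult_least) auto
  then have "\<one> \<in> I" using mem \<phi>(2) by auto
  with I(2) show False ..
qed

end

text \<open>The ideals \<open>J n\<close> generated by the \<open>(n+1)\<close>-st powers of the parameters have exponents that are all
  positive, as \<open>basis_mod_powers\<close> requires, and they satisfy \<open>J n \<subseteq> \<mm>^n\<close>.\<close>

theorem (in complete_regular_local_ring) splits_iff_notin_ideal_smult: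
  assumes M: "module R M" and cm: "big_cohen_macaulay R \<mm> M" and u: "u \<in> carrier M"
  shows "u \<notin> ideal_smult R M \<mm> \<longleftrightarrow> splits R M u"
proof
  interpret module R M by (rule M)
  have one: "\<one> \<notin> \<mm>" using one_imp_carrier I_notcarr by blast
  show "u \<notin> ideal_smult R M \<mm>" if "splits R M u"
    by (rule notin_ideal_smult_if_splits[OF is_ideal one u that])
  assume nu: "u \<notin> ideal_smult R M \<mm>"
  obtain E where E: "u \<in> E" "E \<subseteq> carrier M" "independent_mod R M \<mm> E" "spans_mod R M \<mm> E"
    using exists_basis_mod[OF is_ideal Units_if_not_in_maximal u nu] by blast
  obtain S where S: "finite S" "S \<subseteq> carrier R" "Idl S = \<mm>" "enat (card S) = krull_dim R"
    using regular by blast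
  have reg: "b \<in> ideal_smult R M (Idl ((\<lambda>s. s [^] a s) ` (S - {x})))"
    if x: "x \<in> S" and a: "\<And>s. a s > 0" and b: "b \<in> carrier M"
      and xb: "x \<odot>\<^bsub>M\<^esub> b \<in> ideal_smult R M (Idl ((\<lambda>s. s [^] (a s :: nat)) ` (S - {x})))" for x a b
  proof -
    obtain ys where ys: "set ys = (\<lambda>s. s [^] a s) ` (S - {x})" "system_of_parameters R \<mm> (ys @ [x])"
      using system_of_parameters_powers[where a = a, OF S a x] by blast
    then have "regular_sequence R M (ys @ [x])" using cm unfolding big_cohen_macaulay_def by blast
    then have "\<forall>b \<in> carrier M. (ys @ [x]) ! length ys \<odot>\<^bsub>M\<^esub> b \<in>
        ideal_smult R M (Idl (set (take (length ys) (ys @ [x])))) \<longrightarrow>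
        b \<in> ideal_smult R M (Idl (set (take (length ys) (ys @ [x]))))"
      unfolding regular_sequence_def by (metis length_append_singleton lessI)
    then show ?thesis using b xb ys(1) by simp
  qed
  define J where "J n = Idl ((\<lambda>s. s [^] Suc n) ` S)" for n
  define K where "K n = \<mm> [^]\<^bsub>ideals_set R\<^esub> n" for n :: nat
  have pow: "(\<lambda>s. s [^] Suc n) ` S \<subseteq> carrier R" for n using S(2) by auto
  have JR: "J n \<subseteq> carrier R" for n unfolding J_def by (rule Idl_subset_carrier[OF pow])
  have K: "ideal (K n) R" for n unfolding K_def by (rule ideal_pow_is_ideal[OF is_ideal])
  have basis: "independent_mod R M (J n) E \<and> spans_mod R M (J n) E" for n
    unfolding J_def
    using basis_mod_powers[OF S(1,2) E(2) reg, of "\<lambda>_. Suc n"] E(3,4) S(3) by simp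
  have J_Suc: "J (Suc n) \<subseteq> J n" for n
  proof -
    interpret J: ideal "J n" R unfolding J_def by (rule genideal_ideal[OF pow])
    have "s [^] Suc (Suc n) \<in> J n" if s: "s \<in> S" for s
    proof -
      have "s [^] Suc n \<in> J n" using genideal_self[OF pow] s unfolding J_def by blast
      then show ?thesis using s S(2) J.I_r_closed[of "s [^] Suc n" s] by auto
    qed
    then have "(\<lambda>s. s [^] Suc (Suc n)) ` S \<subseteq> J n" by blast
    then show ?thesis unfolding J_def[of "Suc n"] by (intro genideal_minimal J.is_ideal)
  qed
  have JK: "J n \<subseteq> K n" for n
  proof -
    interpret K: ideal "K n" R by (rule K)
    have "s [^] Suc n \<in> K n" if s: "s \<in> S" for s
    proof -
      have "s \<in> \<mm>" using genideal_self[OF S(2)] S(3) s by blast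
      then have "s [^] n \<in> K n" unfolding K_def by (rule pow_mem_ideal_pow[OF is_ideal])
      then show ?thesis using s S(2) K.I_r_closed[of "s [^] n" s] by auto
    qed
    then have "(\<lambda>s. s [^] Suc n) ` S \<subseteq> K n" by blast
    then show ?thesis unfolding J_def by (intro genideal_minimal K)
  qed
  show "splits R M u"
  proof (rule coordinate_functional[of J K E u])
    show "(\<Inter>n. K n) = {\<zero>}"
      using complete by (simp add: adically_complete_def K_def)
    show "\<exists>y \<in> carrier R. \<forall>n. y \<ominus> x n \<in> K n"
      if "\<And>n. x n \<in> carrier R" "\<And>n. x (Suc n) \<ominus> x n \<in> K n" for x
      using complete that by (simp add: adically_complete_def K_def)
    show "splits R M u" if "\<phi> \<in> dual_module R M" "\<phi> u = \<one>" for \<phi>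
      using that unfolding splits_def by blast
  qed (use JR J_Suc JK K E(1,2) basis in blast)+
qed

section \<open>Algebras over the absolute integral closure\<close>

lemma module_restrict_scalars:
  fixes B :: "('l, 'b, 'm) module_scheme"
  assumes R: "cring R" and B: "module S B" and hom: "\<iota> \<in> ring_hom R S"
  shows "module R (restrict_scalars \<iota> B)"
proof (rule moduleI)
  interpret B: module S B by (rule B)
  note h = ring_hom_memE[OF hom]
  show "cring R" by (rule R)
  show "abelian_group (restrict_scalars \<iota> B)"
  proof (rule abelian_groupI)
    fix x assume "x \<in> carrier (restrict_scalars \<iota> B)"
    then have "\<ominus>\<^bsub>B\<^esub> x \<in> carrier B" "\<ominus>\<^bsub>B\<^esub> x \<oplus>\<^bsub>B\<^esub> x = \<zero>\<^bsub>B\<^esub>"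
      by (simp_all add: restrict_scalars_def B.M.l_neg)
    then show "\<exists>y \<in> carrier (restrict_scalars \<iota> B).
        y \<oplus>\<^bsub>restrict_scalars \<iota> B\<^esub> x = \<zero>\<^bsub>restrict_scalars \<iota> B\<^esub>"
      by (auto simp: restrict_scalars_def)
  qed (simp_all add: restrict_scalars_def B.M.a_ac)
qed (use ring_hom_memE[OF hom] module.smult_closed[OF B] module.smult_l_distr[OF B]
      module.smult_r_distr[OF B] module.smult_assoc1[OF B] module.smult_one[OF B]
     in \<open>simp_all add: restrict_scalars_def\<close>)

text \<open>An element of \<open>R\<close> is integral over \<open>R\<close>, being a root of \<open>X - r\<close>.\<close>

lemma hom_absolute_integral_closure:
  assumes R: "cring R" and L: "algebraic_closure_of_fractions R L \<iota>"
  shows "\<iota> \<in> ring_hom R (absolute_integral_closure R L \<iota>)"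
proof -
  have hom: "\<iota> \<in> ring_hom R L"
    and "algebraic_closure L (generate_field L (\<iota> ` carrier R))"
    using L by (auto simp: algebraic_closure_of_fractions_def)
  then interpret L: field L by (simp add: algebraic_closure_def)
  interpret R: cring R by (rule R)
  interpret h: ring_hom_ring R L \<iota>
    by (intro ring_hom_ringI2 R.ring_axioms L.ring_axioms hom)
  have "\<iota> r \<in> carrier (absolute_integral_closure R L \<iota>)" if r: "r \<in> carrier R" for r
  proof -
    let ?p = "[\<one>\<^bsub>L\<^esub>, \<ominus>\<^bsub>L\<^esub> \<iota> r]"
    have "\<one>\<^bsub>L\<^esub> \<in> \<iota> ` carrier R" using h.hom_one by (metis R.one_closed imageI)
    moreover have "\<ominus>\<^bsub>L\<^esub> \<iota> r \<in> \<iota> ` carrier R" using h.hom_a_inv[OF r] r by (metis R.a_inv_closed imageI)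
    ultimately have "?p \<in> carrier (univ_poly L (\<iota> ` carrier R))"
      unfolding univ_poly_carrier[symmetric] polynomial_def by simp
    moreover have "L.eval ?p (\<iota> r) = \<zero>\<^bsub>L\<^esub>"
      using r by (simp add: L.r_neg)
    ultimately show ?thesis
      unfolding absolute_integral_closure_def using r by (auto intro!: bexI[of _ ?p])
  qed
  then show ?thesis
    using ring_hom_memE[OF hom] by (intro ring_hom_memI) (simp_all add: absolute_integral_closure_def)
qed

text \<open>By restriction of scalars along \<open>R \<rightarrow> R\<^sup>+\<close> this is the criterion for modules, applied to the element
  \<open>f\<^sup>t\<close> of \<open>B\<close>.\<close>

theorem proposition3p6:
  fixes R :: "('a, 'r) ring_scheme" and \<mm> :: "'a set"
    and L :: "('l, 'k) ring_scheme" and \<iota> :: "'a \<Rightarrow> 'l"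
    and B :: "('l, 'b, 'm) module_scheme"
    and f :: 'a
  assumes "complete_regular_local_ring R \<mm>"
    and "f \<in> carrier R" and "f \<noteq> \<zero>\<^bsub>R\<^esub>"
    and "algebraic_closure_of_fractions R L \<iota>"
    and "algebra (absolute_integral_closure R L \<iota>) B"
    and "big_cohen_macaulay R \<mm> (restrict_scalars \<iota> B)"
  shows "\<forall>t::rat. t \<ge> 0 \<longrightarrow>
    (\<forall>u \<in> rational_powers (absolute_integral_closure R L \<iota>) (\<iota> f) t.
       u \<odot>\<^bsub>B\<^esub> \<one>\<^bsub>B\<^esub> \<notin> ideal_smult R (restrict_scalars \<iota> B) \<mm> \<longleftrightarrow>
       splits R (restrict_scalars \<iota> B) (u \<odot>\<^bsub>B\<^esub> \<one>\<^bsub>B\<^esub>))"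
proof (intro allI impI ballI)
  fix t :: rat and u
  let ?S = "absolute_integral_closure R L \<iota>"
  assume u: "u \<in> rational_powers ?S (\<iota> f) t"
  interpret R: complete_regular_local_ring R \<mm> by (rule assms(1))
  interpret B: algebra ?S B by (rule assms(5))
  have M: "module R (restrict_scalars \<iota> B)"
    by (rule module_restrict_scalars[OF R.is_cring B.module
          hom_absolute_integral_closure[OF R.is_cring assms(4)]])
  have "u \<in> carrier ?S"
    using u B.R.nat_pow_closed unfolding rational_powers_def by auto
  then have "u \<odot>\<^bsub>B\<^esub> \<one>\<^bsub>B\<^esub> \<in> carrier (restrict_scalars \<iota> B)"
    by (simp add: restrict_scalars_def)
  then show "u \<odot>\<^bsub>B\<^esub> \<one>\<^bsub>B\<^esub> \<notin> ideal_smult R (restrict_scalars \<iota> B) \<mm> \<longleftrightarrow>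
      splits R (restrict_scalars \<iota> B) (u \<odot>\<^bsub>B\<^esub> \<one>\<^bsub>B\<^esub>)"
    by (rule R.splits_iff_notin_ideal_smult[OF M assms(6)])
qed

end
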